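(* Let $\mathbb{K}$ be an algebraically closed field of characteristic $0$. Let $f\in\mathbb{K}[X,Y,Z]$ be homogeneous of degree $d\ge1$, and suppose $f=f_1^{e_1}\cdots f_r^{e_r}$ where the $f_i$ are pairwise non-proportional irreducible homogeneous polynomials of degrees $d_i$. Then $$\dim_{\mathbb{K}}\ker\mathcal{R}(f)=r-2+\binom{2+\sum_{i=1}^r d_i(e_i-1)}{2}.$$ In particular, $f$ is irreducible if and only if $\dim_{\mathbb{K}}\ker\mathcal{R}(f)=0$.
   Context: $\mathbb{K}[X,Y,Z]_n$ denotes the homogeneous polynomials of degree $n$. Let $E=\{(G,H)\in\mathbb{K}[X,Y,Z]_{d-1}\times\mathbb{K}[X,Y,Z]_{d-1}:\ Z\text{ divides }XG+YH\}$. The $\mathbb{K}$-linear map $\mathcal{R}(f):E\to\mathbb{K}[X,Y,Z]_{2d-3}$ is $(G,H)\mapsto \frac1Z\big(f\,\partial_YG-G\,\partial_Yf-f\,\partial_XH+H\,\partial_Xf\big)=\frac1Z f^2\big(\partial_Y(G/f)-\partial_X(H/f)\big)$ (the division by $Z$ is exact on $E$). *)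

theory Defs
  imports "HOL-Computational_Algebra.Computational_Algebra" "HOL-Library.Product_Plus"
begin

text \<open>Polynomials in K[X,Y,Z] are represented as nested univariate polynomials
  'a poly poly poly: the outermost variable is Z, the middle one Y, the innermost X.
  The coefficient of X^i Y^j Z^k in p is  coeff (coeff (coeff p k) j) i.\<close>

type_synonym 'a poly3 = "'a poly poly poly"

definition mcoeff :: "'a::zero poly3 \<Rightarrow> nat \<Rightarrow> nat \<Rightarrow> nat \<Rightarrow> 'a" where
  "mcoeff p i j k = coeff (coeff (coeff p k) j) i"

definition varX :: "'a::comm_ring_1 poly3" where
  "varX = [:[:[:0, 1:]:]:]"

definition varY :: "'a::comm_ring_1 poly3" where
  "varY = [:[:0, 1:]:]"

definition varZ :: "'a::comm_ring_1 poly3" where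
  "varZ = [:0, 1:]"

definition sc3 :: "'a::comm_ring_1 \<Rightarrow> 'a poly3 \<Rightarrow> 'a poly3" where
  "sc3 c p = [:[:[:c:]:]:] * p"

definition homogeneous :: "'a::zero poly3 \<Rightarrow> nat \<Rightarrow> bool" where
  "homogeneous p n \<longleftrightarrow> (\<forall>i j k. mcoeff p i j k \<noteq> 0 \<longrightarrow> i + j + k = n)"

definition hom_polys :: "nat \<Rightarrow> 'a::zero poly3 set" where
  "hom_polys n = {p. homogeneous p n}"

definition dX :: "'a::idom poly3 \<Rightarrow> 'a poly3" where
  "dX p = map_poly (map_poly pderiv) p"

definition dY :: "'a::idom poly3 \<Rightarrow> 'a poly3" where
  "dY p = map_poly pderiv p"

definition dZ :: "'a::idom poly3 \<Rightarrow> 'a poly3" where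
  "dZ p = pderiv p"

definition Espace :: "nat \<Rightarrow> ('a::comm_ring_1 poly3 \<times> 'a poly3) set" where
  "Espace d = {(G, H). G \<in> hom_polys (d - 1) \<and> H \<in> hom_polys (d - 1)
                \<and> varZ dvd (varX * G + varY * H)}"

definition Rmap :: "'a::idom poly3 \<Rightarrow> 'a poly3 \<times> 'a poly3 \<Rightarrow> 'a poly3" where
  "Rmap f GH = (case GH of (G, H) \<Rightarrow>
     (THE Q. f * dY G - G * dY f - f * dX H + H * dX f = varZ * Q))"

definition Rker :: "nat \<Rightarrow> 'a::idom poly3 \<Rightarrow> ('a poly3 \<times> 'a poly3) set" where
  "Rker d f = {v \<in> Espace d. Rmap f v = 0}"

definition sc_pair :: "'a::comm_ring_1 \<Rightarrow> 'a poly3 \<times> 'a poly3 \<Rightarrow> 'a poly3 \<times> 'a poly3" where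
  "sc_pair c v = (sc3 c (fst v), sc3 c (snd v))"

definition dimK :: "('a::field poly3 \<times> 'a poly3) set \<Rightarrow> nat" where
  "dimK S = Vector_Spaces.vector_space.dim sc_pair S"

end

theory Submission
  imports Defs "Berlekamp_Zassenhaus.Unique_Factorization_Poly"
begin

text \<open>
  A pair \<open>(G, H)\<close> of the space determines \<open>K\<close> with \<open>X G + Y H + Z K = 0\<close>, and it lies in the kernel
  iff the rational 1-form \<open>\<eta> = (G dX + H dY + K dZ) / f\<close> is closed. Integrating one variable at a time,
  every closed form over a rational function field is a combination of logarithmic differentials with
  constant coefficients plus an exact form: in the last variable, multiple poles are removed by
  subtracting exact forms, and the residue along a simple pole is annihilated by all derivations,
  hence algebraic over, hence contained in, the constant field. Comparing poles in the factorial ring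
  of polynomials, only the \<open>f\<^sub>i\<close> contribute and \<open>\<eta> = \<Sum>\<^sub>i \<lambda>\<^sub>i df\<^sub>i / f\<^sub>i + d(A / q)\<close> with
  \<open>q = \<Prod>\<^sub>i f\<^sub>i ^ (e\<^sub>i - 1)\<close>. The Euler relation makes \<open>A\<close> homogeneous of degree \<open>s = deg q\<close> and
  \<open>\<Sum>\<^sub>i \<lambda>\<^sub>i d\<^sub>i = 0\<close>; such a form vanishes iff \<open>\<lambda> = 0\<close> and \<open>A\<close> is a multiple of \<open>q\<close>. So the
  dimension is \<open>(r - 1) + (binomial (s + 2) 2 - 1)\<close>.
\<close>

text \<open>Splitting off poles needs inverses modulo a prime. These exist for univariate
  polynomials over a field, but in general not in K[X,Y,Z], where a prime need not generate a
  maximal ideal. Hence the detour through K(X)(Y)(Z), in which logarithms of arbitrary field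
  elements appear; only afterwards are they factored over K[X,Y,Z] and matched with the given
  factors. What is carried up the tower besides integrability is that the common kernel of the
  derivations is exactly K: a residue in the new variable lives in a finite extension of the field
  below, and only the algebraic closedness of the constants brings it back to K. Characteristic 0
  enters mainly through one fact: a derivative never has a simple pole along a prime that the
  derivation does not preserve. It makes residues constant, it separates the logarithmic from the
  exact part, and it makes a primitive lose one pole order, which is where the exponents
  \<open>es i - 1\<close> come from.\<close>

section \<open>Derivations and their extension to fraction fields\<close>

definition derivation :: "('r::comm_ring_1 \<Rightarrow> 'r) \<Rightarrow> bool" where
  "derivation D \<longleftrightarrow> (\<forall>x y. D (x + y) = D x + D y) \<and> (\<forall>x y. D (x * y) = D x * y + x * D y)"

lemma derivation_add: "derivation D \<Longrightarrow> D (x + y) = D x + D y"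
  and derivation_mult: "derivation D \<Longrightarrow> D (x * y) = D x * y + x * D y"
  by (auto simp: derivation_def)

lemma derivation_0: "derivation D \<Longrightarrow> D 0 = 0"
  using derivation_add[of D 0 0] by simp

lemma derivation_1: "derivation D \<Longrightarrow> D 1 = 0"
  using derivation_mult[of D 1 1] by simp

lemma derivation_uminus: "derivation D \<Longrightarrow> D (- x) = - D x"
  using derivation_add[of D x "- x"] by (simp add: derivation_0 add_eq_0_iff)

lemma derivation_diff: "derivation D \<Longrightarrow> D (x - y) = D x - D y"
  using derivation_add[of D x "- y"] by (simp add: derivation_uminus)

lemma derivation_sum: "derivation D \<Longrightarrow> D (\<Sum>i\<in>A. f i) = (\<Sum>i\<in>A. D (f i))"
  by (induction A rule: infinite_finite_induct) (auto simp: derivation_0 derivation_add)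

lemma derivation_of_nat: "derivation D \<Longrightarrow> D (of_nat k) = 0"
  by (induction k) (auto simp: derivation_0 derivation_add derivation_1)

lemma derivation_power_Suc:
  "derivation D \<Longrightarrow> D (x ^ Suc k) = of_nat (Suc k) * x ^ k * D x"
proof (induction k)
  case (Suc k)
  have "D (x ^ Suc (Suc k)) = D x * x ^ Suc k + x * D (x ^ Suc k)"
    using derivation_mult[OF Suc.prems, of x "x ^ Suc k"] by simp
  also have "\<dots> = of_nat (Suc (Suc k)) * x ^ Suc k * D x"
    unfolding Suc.IH[OF Suc.prems] by (simp add: algebra_simps)
  finally show ?case .
qed simp

lemma derivation_divide:
  fixes D :: "'l::field \<Rightarrow> 'l"
  assumes "derivation D" "y \<noteq> 0"
  shows "D (x / y) = (D x * y - x * D y) / (y * y)"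
proof -
  have "D x = D (x / y * y)" using assms by simp
  also have "\<dots> = D (x / y) * y + x / y * D y" by (rule derivation_mult[OF assms(1)])
  finally show ?thesis using assms(2) by (simp add: field_simps)
qed

lemma derivation_dlog_divide:
  fixes D :: "'l::field \<Rightarrow> 'l"
  assumes "derivation D" "x \<noteq> 0" "y \<noteq> 0"
  shows "D (x / y) / (x / y) = D x / x - D y / y"
  using assms by (simp add: derivation_divide field_simps)

lemma derivation_dlog_mult:
  fixes D :: "'l::field \<Rightarrow> 'l"
  assumes "derivation D" "x \<noteq> 0" "y \<noteq> 0"
  shows "D (x * y) / (x * y) = D x / x + D y / y"
  using assms by (simp add: derivation_mult field_simps)

lemma derivation_pderiv: "derivation (pderiv :: 'a::idom poly \<Rightarrow> _)"
  by (auto simp: derivation_def pderiv_add pderiv_mult)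

lemma derivation_map_poly:
  assumes "derivation D"
  shows "derivation (map_poly D)"
  unfolding derivation_def
  by (auto intro!: poly_eqI simp: coeff_map_poly derivation_0[OF assms] derivation_add[OF assms]
      coeff_mult derivation_sum[OF assms] derivation_mult[OF assms] sum.distrib)

lemma map_poly_pderiv_commute:
  assumes "derivation D"
  shows "map_poly D (pderiv p) = pderiv (map_poly D p)"
  by (intro poly_eqI) (simp add: coeff_map_poly derivation_0[OF assms] coeff_pderiv
      derivation_mult[OF assms] derivation_of_nat[OF assms] derivation_add[OF assms] derivation_1[OF assms])

lemma map_poly_commute:
  assumes "derivation D" "derivation E" "\<And>x. D (E x) = E (D x)"
  shows "map_poly D (map_poly E p) = map_poly E (map_poly D p)"
  by (intro poly_eqI) (simp add: coeff_map_poly derivation_0 assms)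

text \<open>The quotient rule applied to an arbitrarily chosen representative;
  \<open>frac_der_Fract\<close> shows that the choice is immaterial.\<close>

definition frac_der :: "('r::idom \<Rightarrow> 'r) \<Rightarrow> 'r fract \<Rightarrow> 'r fract" where
  "frac_der D x = (let (a, b) = (SOME (a, b). b \<noteq> 0 \<and> x = Fract a b)
                   in Fract (D a * b - a * D b) (b * b))"

lemma frac_der_Fract:
  assumes D: "derivation D" and b: "b \<noteq> 0"
  shows "frac_der D (Fract a b) = Fract (D a * b - a * D b) (b * b)"
proof -
  obtain a' b' where ab: "(SOME (a', b'). b' \<noteq> 0 \<and> Fract a b = Fract a' b') = (a', b')"
    by fastforce
  have "case (SOME (a', b'). b' \<noteq> 0 \<and> Fract a b = Fract a' b') of (a', b') \<Rightarrow> b' \<noteq> 0 \<and> Fract a b = Fract a' b'"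
    by (rule someI[of _ "(a, b)"]) (simp add: b)
  then have b': "b' \<noteq> 0" and eq: "Fract a b = Fract a' b'" by (auto simp: ab)
  from eq b b' have e: "a * b' = a' * b" by (simp add: eq_fract)
  then have "D (a * b') = D (a' * b)" by simp
  then have e': "D a * b' + a * D b' = D a' * b + a' * D b" by (simp add: derivation_mult[OF D])
  have "(D a' * b' - a' * D b') * (b * b) = (D a * b - a * D b) * (b' * b')"
  proof -
    \<comment> \<open>The cross difference is a combination of the relation
      \<open>a * b' = a' * b\<close> and of its derivative.\<close>
    have "(D a * b - a * D b) * (b' * b') - (D a' * b' - a' * D b') * (b * b)
        = b * b' * ((D a * b' + a * D b') - (D a' * b + a' * D b))
          + (a' * b - a * b') * (b' * D b + b * D b')"
      by (simp add: algebra_simps)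
    also have "\<dots> = 0" by (simp add: e e')
    finally show ?thesis by simp
  qed
  then have "Fract (D a' * b' - a' * D b') (b' * b') = Fract (D a * b - a * D b) (b * b)"
    using b b' by (simp add: eq_fract)
  then show ?thesis by (simp add: frac_der_def ab)
qed

lemma frac_der_to_fract:
  assumes D: "derivation D"
  shows "frac_der D (to_fract a) = to_fract (D a)"
  by (simp add: to_fract_def frac_der_Fract[OF D] derivation_1[OF D])

lemma derivation_frac_der:
  assumes D: "derivation D"
  shows "derivation (frac_der D)"
  unfolding derivation_def
proof (intro conjI allI)
  fix x y :: "'a fract"
  obtain a b c d where x: "x = Fract a b" "b \<noteq> 0" and y: "y = Fract c d" "d \<noteq> 0"
    by (cases x, cases y)
  have "D (a * d + c * b) * (b * d) - (a * d + c * b) * D (b * d)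
      = (D a * b - a * D b) * (d * d) + (D c * d - c * D d) * (b * b)"
    by (simp add: derivation_add[OF D] derivation_mult[OF D] algebra_simps)
  then show "frac_der D (x + y) = frac_der D x + frac_der D y"
    using x y by (simp add: frac_der_Fract[OF D] eq_fract mult.left_commute mult.commute mult.assoc)
  have *: "(D a * b - a * D b) * c * (b * (d * d)) + a * (D c * d - c * D d) * (b * b * d)
      = (D (a * c) * (b * d) - a * c * D (b * d)) * (b * d)"
    by (simp add: derivation_mult[OF D] algebra_simps)
  have "frac_der D x * y + x * frac_der D y
      = Fract ((D a * b - a * D b) * c * (b * (d * d)) + a * (D c * d - c * D d) * (b * b * d)) (b * b * d * (b * (d * d)))"
    using x y by (simp add: frac_der_Fract[OF D])
  also have "\<dots> = Fract (D (a * c) * (b * d) - a * c * D (b * d)) (b * d * (b * d))"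
    unfolding * using x y by (subst eq_fract) (auto simp: mult.left_commute mult.commute mult.assoc)
  also have "\<dots> = frac_der D (x * y)"
    using x y by (simp add: frac_der_Fract[OF D])
  finally show "frac_der D (x * y) = frac_der D x * y + x * frac_der D y" ..
qed

lemma derivation_commutator:
  assumes "derivation D" "derivation E"
  shows "derivation (\<lambda>x. D (E x) - E (D x))"
  unfolding derivation_def by (simp add: derivation_add derivation_mult assms algebra_simps)

text \<open>The commutator of two derivations is again a derivation. It vanishes on the ring, hence
  on quotients by the quotient rule, which avoids computing second derivatives of fractions.\<close>

lemma frac_der_commute:
  assumes D: "derivation D" and E: "derivation E" and c: "\<And>x. D (E x) = E (D x)"
  shows "frac_der D (frac_der E x) = frac_der E (frac_der D x)"
proof -
  define C where "C x = frac_der D (frac_der E x) - frac_der E (frac_der D x)" for x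
  have C: "derivation C" unfolding C_def
    by (intro derivation_commutator derivation_frac_der D E)
  have C0: "C (to_fract a) = 0" for a
    by (simp add: C_def frac_der_to_fract D E c)
  obtain a b where x: "x = Fract a b" "b \<noteq> 0" by (cases x)
  have "C x = 0"
    using x(2) unfolding x(1) Fract_conv_to_fract by (simp add: derivation_divide[OF C] C0)
  then show ?thesis by (simp add: C_def)
qed

text \<open>Lets the passage from a field to its rational function field be iterated.\<close>

instance fract :: ("{idom, ring_char_0}") field_char_0
proof
  show "inj (of_nat :: nat \<Rightarrow> 'a fract)"
    by (rule injI) (simp add: of_nat_fract eq_fract)
qed

section \<open>Regularity at a prime\<close>

text \<open>Membership in the local ring at \<open>p\<close>. No valuation is introduced: a pole of
  order at most m is expressed as regularity of the product with the m-th power of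
  \<open>p\<close>.\<close>

definition regular_at :: "('r::comm_ring_1 \<Rightarrow> 'm::comm_ring_1) \<Rightarrow> 'r \<Rightarrow> 'm \<Rightarrow> bool" where
  "regular_at emb p x \<longleftrightarrow> (\<exists>a b. \<not> p dvd b \<and> x * emb b = emb a)"

lemma regular_atE:
  assumes "regular_at emb p x"
  obtains a b where "\<not> p dvd b" "x * emb b = emb a"
  using assms unfolding regular_at_def by (elim exE conjE)

lemma regular_atI: "\<not> p dvd b \<Longrightarrow> x * emb b = emb a \<Longrightarrow> regular_at emb p x"
  unfolding regular_at_def by (intro exI conjI)

text \<open>Induction over a factorization into irreducibles: a factor divisible by \<open>p\<close>
  is \<open>p\<close> times a unit, and every other factor can be left in \<open>y\<close>.\<close>

lemma prime_power_decomposition: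
  fixes p x :: "'r::ufd"
  assumes p: "prime_elem p" and x: "x \<noteq> 0"
  obtains k y where "x = p ^ k * y" "\<not> p dvd y"
proof -
  have *: "\<exists>k y. prod_mset F = p ^ k * y \<and> \<not> p dvd y" if "\<forall>q\<in>#F. irreducible q" for F
    using that
  proof (induction F)
    case empty
    then show ?case using prime_elem_not_unit[OF p] by (intro exI[of _ 0] exI[of _ 1]) auto
  next
    case (add q F)
    then obtain k y where ky: "prod_mset F = p ^ k * y" "\<not> p dvd y" by auto
    show ?case
    proof (cases "p dvd q")
      case False
      then show ?thesis using ky prime_elem_dvd_mult_iff[OF p]
        by (intro exI[of _ k] exI[of _ "q * y"]) (auto simp: ac_simps)
    next
      case True
      then obtain w where w: "q = p * w" by (elim dvdE)
      have "irreducible q" using add.prems by simp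
      from irreducibleD[OF this w] have "w dvd 1" using prime_elem_not_unit[OF p] by auto
      then have "\<not> p dvd w" using prime_elem_not_unit[OF p] dvd_trans by blast
      then show ?thesis using ky w prime_elem_dvd_mult_iff[OF p]
        by (intro exI[of _ "Suc k"] exI[of _ "w * y"]) (auto simp: ac_simps)
    qed
  qed
  show thesis
  proof (cases "x dvd 1")
    case True
    then show thesis using that[of 0 x] prime_elem_not_unit[OF p] dvd_trans by auto
  next
    case False
    from mset_factors_exist[OF x False] obtain F where "mset_factors F x" by blast
    then have "prod_mset F = x" "\<forall>q\<in>#F. irreducible q" by (auto dest: mset_factorsD)
    with *[of F] that show thesis by auto
  qed
qed

text \<open>Serves two settings: L[t] inside L(t) at each level of the tower, and K[X,Y,Z] inside
  the whole tower. The assumption \<open>of_nat_unit\<close> is characteristic 0 in the form in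
  which it is used: no prime divides the exponent that differentiation brings down.\<close>

locale fraction_embedding = inj_idom_hom emb for emb :: "'r::ufd \<Rightarrow> 'm::field" +
  assumes quot: "\<exists>a b. b \<noteq> 0 \<and> x = emb a / emb b"
    and of_nat_unit: "k > 0 \<Longrightarrow> (of_nat k :: 'r) dvd 1"
begin

lemmas emb_simps = hom_mult hom_add hom_uminus hom_minus hom_power hom_of_nat hom_one hom_zero

abbreviation "reg \<equiv> regular_at emb"

lemma reg_emb: "prime_elem p \<Longrightarrow> reg p (emb a)"
  using prime_elem_not_unit[of p] unfolding regular_at_def by (intro exI[of _ a] exI[of _ 1]) auto

lemma reg_add:
  assumes p: "prime_elem p" and "reg p x" "reg p y"
  shows "reg p (x + y)"
proof -
  obtain a b where 1: "\<not> p dvd b" "x * emb b = emb a" using assms(2) by (rule regular_atE)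
  obtain c d where 2: "\<not> p dvd d" "y * emb d = emb c" using assms(3) by (rule regular_atE)
  have "(x + y) * emb (b * d) = x * emb b * emb d + emb b * (y * emb d)"
    by (simp only: hom_mult algebra_simps)
  also have "\<dots> = emb (a * d + b * c)"
    by (simp only: 1 2 hom_mult hom_add)
  finally show ?thesis using 1(1) 2(1) prime_elem_dvd_mult_iff[OF p] by (intro regular_atI) auto
qed

lemma reg_mult:
  assumes p: "prime_elem p" and "reg p x" "reg p y"
  shows "reg p (x * y)"
proof -
  obtain a b where 1: "\<not> p dvd b" "x * emb b = emb a" using assms(2) by (rule regular_atE)
  obtain c d where 2: "\<not> p dvd d" "y * emb d = emb c" using assms(3) by (rule regular_atE)
  have "(x * y) * emb (b * d) = (x * emb b) * (y * emb d)"
    by (simp only: hom_mult algebra_simps)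
  also have "\<dots> = emb (a * c)"
    by (simp only: 1 2 hom_mult)
  finally show ?thesis using 1(1) 2(1) prime_elem_dvd_mult_iff[OF p] by (intro regular_atI) auto
qed

lemma reg_uminus:
  assumes p: "prime_elem p" and "reg p x"
  shows "reg p (- x)"
  using reg_mult[OF p reg_emb[OF p, of "-1"] assms(2)] by (simp add: emb_simps)

lemma reg_diff:
  assumes p: "prime_elem p" and "reg p x" "reg p y"
  shows "reg p (x - y)"
  using reg_add[OF p assms(2) reg_uminus[OF p assms(3)]] by simp

lemma reg_sum:
  assumes p: "prime_elem p" and "\<And>i. i \<in> A \<Longrightarrow> reg p (f i)"
  shows "reg p (\<Sum>i\<in>A. f i)"
  using assms(2)
  by (induction A rule: infinite_finite_induct) (use reg_emb[OF p, of 0] in \<open>auto intro!: reg_add[OF p]\<close>)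

lemma reg_divide:
  assumes p: "prime_elem p" and "reg p x" "\<not> p dvd b"
  shows "reg p (x / emb b)"
proof -
  obtain c d where *: "\<not> p dvd d" "x * emb d = emb c" using assms(2) by (rule regular_atE)
  have b: "b \<noteq> 0" using assms(3) by auto
  have "\<not> p dvd b * d" using assms(3) * prime_elem_dvd_mult_iff[OF p] by auto
  moreover have "x / emb b * emb (b * d) = emb c" using * b by (simp add: emb_simps)
  ultimately show ?thesis by (rule regular_atI)
qed

lemma reg_div_emb:
  "prime_elem p \<Longrightarrow> \<not> p dvd b \<Longrightarrow> reg p (emb a / emb b)"
  by (intro reg_divide reg_emb)

lemma dvd_of_reg:
  assumes p: "prime_elem p" and "reg p (emb a / emb p)"
  shows "p dvd a"
proof -
  obtain c d where *: "\<not> p dvd d" "emb a / emb p * emb d = emb c" using assms(2) by (rule regular_atE)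
  have "p \<noteq> 0" using p by (rule prime_elem_not_zeroI)
  then have "emb (a * d) = emb (p * c)" using * by (simp add: emb_simps field_simps)
  then have "p dvd a * d" by simp
  then show ?thesis using * prime_elem_dvd_mult_iff[OF p] by auto
qed

lemma reg_derivation:
  assumes p: "prime_elem p" and D: "derivation D" "\<And>a. D (emb a) = emb (d a)" and x: "reg p x"
  shows "reg p (D x)"
proof -
  obtain a b where *: "\<not> p dvd b" "x * emb b = emb a" using x by (rule regular_atE)
  then have b: "emb b \<noteq> 0" by auto
  then have "x = emb a / emb b" using * by (simp add: field_simps)
  then have "D x = emb (d a * b - a * d b) / emb (b * b)"
    by (simp add: derivation_divide[OF D(1) b] D(2) emb_simps)
  moreover have "\<not> p dvd b * b" using * prime_elem_dvd_mult_iff[OF p] by auto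
  ultimately show ?thesis using reg_div_emb[OF p] by simp
qed

text \<open>Cancelling the powers of \<open>p\<close> in numerator and denominator leaves either no
  pole or a pole of exact order k; this dichotomy stands in for a valuation.\<close>

lemma reg_cases:
  assumes p: "prime_elem p"
  obtains "reg p x" | k a b where "k > 0" "\<not> p dvd a" "\<not> p dvd b" "x = emb a / (emb b * emb p ^ k)"
proof -
  obtain a b where ab: "b \<noteq> 0" "x = emb a / emb b" using quot by blast
  have p0: "emb p \<noteq> 0" using prime_elem_not_zeroI[OF p] by simp
  show thesis
  proof (cases "a = 0")
    case True
    then show thesis using that(1) reg_emb[OF p, of 0] ab by simp
  next
    case False
    obtain k a' where a': "a = p ^ k * a'" "\<not> p dvd a'" using prime_power_decomposition[OF p False] .
    obtain l b' where b': "b = p ^ l * b'" "\<not> p dvd b'" using prime_power_decomposition[OF p ab(1)] .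
    have b0: "emb b' \<noteq> 0" using b' by auto
    show thesis
    proof (cases "l \<le> k")
      case True
      then obtain j where "k = l + j" by (auto dest: le_Suc_ex)
      then have "x = emb (p ^ j * a') / emb b'"
        using ab a' b' p0 b0 by (simp add: emb_simps power_add)
      then show thesis using that(1) reg_div_emb[OF p b'(2)] by simp
    next
      case False
      then obtain j where j: "l = k + j" "j > 0" using less_imp_add_positive[of k l] by auto
      then have "x = emb a' / (emb b' * emb p ^ j)"
        using ab a' b' p0 b0 by (simp add: emb_simps power_add)
      then show thesis using that(2)[of j a' b'] j a' b' by simp
    qed
  qed
qed

text \<open>In characteristic 0 a derivation that does not preserve the prime \<open>p\<close> raises the order of
  a pole along \<open>p\<close> by exactly one.\<close>

lemma pole_order_derivation:
  assumes p: "prime_elem p" and D: "derivation D" "\<And>a. D (emb a) = emb (d a)" and dp: "\<not> p dvd d p"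
    and x: "reg p (emb p ^ Suc m * D x)"
  shows "reg p (emb p ^ m * x)"
proof (cases rule: reg_cases[OF p, of "x"])
  case 1
  then show ?thesis using reg_mult[OF p reg_emb[OF p, of "p ^ m"]] by (simp add: emb_simps)
next
  case (2 k a b)
  have p0: "emb p \<noteq> 0" using prime_elem_not_zeroI[OF p] by simp
  have b0: "emb b \<noteq> 0" using 2 by auto
  obtain j where k: "k = Suc j" using 2 by (cases k) auto
  show ?thesis
  proof (cases "k \<le> m")
    case True
    then obtain i where "m = k + i" by (auto dest: le_Suc_ex)
    then have "emb p ^ m * x = emb (p ^ i * a) / emb b"
      using 2 p0 b0 by (simp add: emb_simps power_add)
    then show ?thesis using reg_div_emb[OF p] 2 by simp
  next
    case False
    \<comment> \<open>Differentiating \<open>u = x * p ^ k\<close> and multiplying by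
      \<open>p\<close> expresses \<open>k * u * d p\<close> through \<open>p * D u\<close> and
      \<open>p ^ (k + 1) * D x\<close>. For k > m both are \<open>p\<close> times something regular,
      so \<open>p\<close> would divide \<open>a * k * d p\<close>, a product of factors prime to
      \<open>p\<close>.\<close>
    define u where "u = emb a / emb b"
    have u: "reg p u" using reg_div_emb[OF p] 2 by (simp add: u_def)
    have xk: "x * emb p ^ k = u" using 2 p0 b0 by (simp add: u_def field_simps)
    have "D u = D x * emb p ^ k + x * (of_nat k * emb p ^ j * emb (d p))"
      unfolding xk[symmetric] k derivation_mult[OF D(1)] derivation_power_Suc[OF D(1)] D(2) by simp
    then have "emb p * D u = D x * emb p ^ Suc k + of_nat k * (x * emb p ^ k) * emb (d p)"
      by (simp add: k algebra_simps)
    also have "D x * emb p ^ Suc k = emb p ^ (k - m) * (emb p ^ Suc m * D x)"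
      using False by (simp add: algebra_simps flip: power_add)
    finally have "u * emb (of_nat k * d p) = emb p * D u - emb p ^ (k - m) * (emb p ^ Suc m * D x)"
      by (simp add: xk emb_simps algebra_simps)
    also have "emb p ^ (k - m) = emb p * emb (p ^ (k - m - 1))"
      using False by (cases "k - m") (auto simp: emb_simps)
    finally have "u * emb (of_nat k * d p) / emb p = D u - emb (p ^ (k - m - 1)) * (emb p ^ Suc m * D x)"
      using p0 by (simp add: field_simps)
    moreover have "reg p \<dots>"
      by (rule reg_diff[OF p reg_derivation[OF p D u] reg_mult[OF p reg_emb[OF p] x]])
    ultimately have "reg p (u * emb (of_nat k * d p) / emb p)" by simp
    from reg_mult[OF p reg_emb[OF p, of b] this] have "reg p (emb (a * (of_nat k * d p)) / emb p)"
      using b0 by (simp add: u_def emb_simps)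
    then have "p dvd a * (of_nat k * d p)" by (rule dvd_of_reg[OF p])
    moreover have "\<not> p dvd of_nat k"
      using of_nat_unit[of k] 2 prime_elem_not_unit[OF p] dvd_trans by blast
    ultimately show ?thesis using 2 dp prime_elem_dvd_mult_iff[OF p] by blast
  qed
qed

text \<open>A factorial ring is the intersection of its localizations at primes: the irreducible
  factors of a denominator are cancelled one at a time, each by regularity at that factor, and a
  unit denominator is finally absorbed.\<close>

lemma emb_if_regular:
  assumes "\<And>p. prime_elem p \<Longrightarrow> reg p x"
  shows "\<exists>a. x = emb a"
proof -
  have *: "\<exists>c. x = emb c / emb u" if "\<forall>q\<in>#F. irreducible q" "x = emb a / emb (u * prod_mset F)" "u * prod_mset F \<noteq> 0" for F a u
    using that
  proof (induction F arbitrary: a)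
    case (add q F)
    then have q: "prime_elem q" and nz: "u * prod_mset F \<noteq> 0" "q \<noteq> 0" by auto
    obtain s t where st: "\<not> q dvd t" "x * emb t = emb s" using assms[OF q] by (rule regular_atE)
    have "emb (a * t) = emb (s * (q * (u * prod_mset F)))"
      using st add.prems nz by (simp add: emb_simps field_simps)
    then have "a * t = s * (q * (u * prod_mset F))" by simp
    then have "q dvd a * t" by auto
    then obtain a' where a': "a = q * a'" using st prime_elem_dvd_mult_iff[OF q] by (auto elim: dvdE)
    have "x = emb a' / emb (u * prod_mset F)" using add.prems a' nz by (simp add: emb_simps field_simps)
    then show ?case using add nz by auto
  qed auto
  obtain a b where ab: "b \<noteq> 0" "x = emb a / emb b" using quot by blast
  have "\<exists>c u. u dvd 1 \<and> x = emb c / emb u"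
  proof (cases "b dvd 1")
    case False
    from mset_factors_exist[OF ab(1) this] obtain F where "mset_factors F b" by blast
    then have "prod_mset F = b" "\<forall>q\<in>#F. irreducible q" by (auto dest: mset_factorsD)
    with *[of F a 1] ab obtain c where "x = emb c / emb 1" by auto
    then show ?thesis using one_dvd by blast
  qed (use ab in blast)
  then obtain c u where cu: "u dvd 1" "x = emb c / emb u" by blast
  then obtain v where v: "1 = u * v" by (elim dvdE)
  then have "emb u * emb v = 1" by (metis hom_mult hom_one)
  then have "inverse (emb u) = emb v" by (rule inverse_unique)
  then have "x = emb (c * v)" using cu by (simp add: hom_mult divide_inverse)
  then show ?thesis by blast
qed

end

section \<open>Closed logarithmic forms over a rational function field\<close>

text \<open>A nonzero element of least degree in the ideal generated by \<open>P\<close> and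
  \<open>y\<close> divides both, by division with remainder. Were it not a unit, it would be
  associated to \<open>P\<close>, and \<open>P\<close> would divide \<open>y\<close>.\<close>

lemma inverse_mod_prime:
  fixes P y :: "'l::field poly"
  assumes P: "prime_elem P" and y: "\<not> P dvd y"
  obtains v where "P dvd v * y - 1"
proof -
  define I where "I = {w. w \<noteq> 0 \<and> (\<exists>u v. w = u * P + v * y)}"
  have "P = 1 * P + 0 * y" by simp
  then have "P \<in> I" using prime_elem_not_zeroI[OF P] unfolding I_def by blast
  then obtain w where w: "w \<in> I" and min: "\<And>z. z \<in> I \<Longrightarrow> degree w \<le> degree z"
    using ex_has_least_nat[of "\<lambda>z. z \<in> I" P degree] by blast
  from w obtain u v where uv: "w = u * P + v * y" and w0: "w \<noteq> 0" unfolding I_def by blast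
  have dvd: "w dvd u' * P + v' * y" for u' v'
  proof (rule ccontr)
    let ?z = "u' * P + v' * y"
    assume "\<not> w dvd ?z"
    then have nz: "?z mod w \<noteq> 0" by (simp add: dvd_eq_mod_eq_0)
    have "?z mod w = ?z - (?z div w) * w" by (simp add: minus_div_mult_eq_mod)
    also have "\<dots> = (u' - (?z div w) * u) * P + (v' - (?z div w) * v) * y"
      by (subst (2) uv) (simp add: algebra_simps)
    finally have "?z mod w \<in> I" unfolding I_def using nz by blast
    then have "degree w \<le> degree (?z mod w)" by (rule min)
    with degree_mod_less[OF w0, of ?z] nz show False by auto
  qed
  have wP: "w dvd P" using dvd[of 1 0] by simp
  have wy: "w dvd y" using dvd[of 0 1] by simp
  have "w dvd 1"
  proof (rule ccontr)
    assume n: "\<not> w dvd 1"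
    obtain t where t: "P = w * t" using wP by (elim dvdE)
    have "t dvd 1" using irreducibleD[OF prime_elem_imp_irreducible[OF P] t] n by auto
    then have "P dvd w" unfolding t using mult_dvd_mono[of w w t 1] by simp
    then show False using wy y dvd_trans by blast
  qed
  then obtain s where s: "1 = w * s" by (elim dvdE)
  then have "s * v * y - 1 = P * (- s * u)" unfolding uv by (simp add: algebra_simps)
  then show thesis using that[of "s * v"] by (metis dvd_triv_left)
qed

text \<open>The residue class of \<open>w\<close> is algebraic over the ground field: its powers up
  to exponent \<open>degree P\<close> are one more than the dimension of the residue ring.\<close>

lemma algebraic_relation_mod:
  fixes P w :: "'l::field poly"
  assumes P: "degree P > 0"
  obtains m where "m \<noteq> 0" "P dvd pcompose m w"
proof -
  interpret V: vector_space "smult :: 'l \<Rightarrow> 'l poly \<Rightarrow> 'l poly"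
    by unfold_locales (auto simp: smult_add_left smult_add_right)
  define f where "f i = w ^ i mod P" for i
  have P0: "P \<noteq> 0" using P by auto
  have pm: "pcompose (monom c i) w = smult c (w ^ i)" for c i
    by (simp add: monom_altdef pcompose_smult pcompose_hom.hom_power pcompose_pCons)
  show thesis
  \<comment> \<open>Linear dependence speaks about sets, so two coinciding powers are treated
    separately; there the relation is a difference of two monomials.\<close>
  proof (cases "inj_on f {..degree P}")
    case False
    then obtain i j where ij: "i \<noteq> j" "f i = f j" by (auto simp: inj_on_def)
    have "monom (1::'l) i - monom 1 j \<noteq> 0"
    proof
      assume "monom (1::'l) i - monom 1 j = 0"
      then have "coeff (monom (1::'l) i) i = coeff (monom 1 j) i" by simp
      then show False using ij by simp
    qed
    moreover have "P dvd pcompose (monom 1 i - monom 1 j) w"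
      using ij by (simp add: pcompose_diff pm f_def mod_eq_dvd_iff)
    ultimately show thesis by (rule that)
  next
    case True
    have span: "q \<in> V.span (monom 1 ` {..<degree P})" if "degree q < degree P" for q
    proof -
      have "q = (\<Sum>i\<le>degree q. smult (coeff q i) (monom 1 i))"
        by (simp add: smult_monom poly_as_sum_of_monoms)
      also have "\<dots> \<in> V.span (monom 1 ` {..<degree P})"
        using that by (intro V.span_sum V.span_scale V.span_base) auto
      finally show ?thesis .
    qed
    have sub: "f ` {..degree P} \<subseteq> V.span (monom 1 ` {..<degree P})"
    proof (rule image_subsetI)
      fix i
      have "degree (f i) < degree P"
        using degree_mod_less[OF P0, of "w ^ i"] P by (auto simp: f_def)
      then show "f i \<in> V.span (monom 1 ` {..<degree P})" by (rule span)
    qed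
    have "V.dependent (f ` {..degree P})"
    proof (rule ccontr)
      assume "\<not> V.dependent (f ` {..degree P})"
      from V.independent_span_bound[OF _ this sub]
      have "card (f ` {..degree P}) \<le> card (monom (1::'l) ` {..<degree P})" by simp
      also have "\<dots> \<le> degree P" using card_image_le[of "{..<degree P}" "monom (1::'l)"] by simp
      finally show False by (simp add: card_image[OF True])
    qed
    then obtain u where u: "\<exists>v\<in>f ` {..degree P}. u v \<noteq> 0" "(\<Sum>v\<in>f ` {..degree P}. smult (u v) v) = 0"
      using V.dependent_finite[of "f ` {..degree P}"] by auto
    define m where "m = (\<Sum>i\<le>degree P. monom (u (f i)) i)"
    have cm: "coeff m i = u (f i)" if "i \<le> degree P" for i
      using that by (simp add: m_def coeff_sum if_distrib)
    have "m \<noteq> 0" using u(1) cm by fastforce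
    have "pcompose m w = (\<Sum>i\<le>degree P. smult (u (f i)) (w ^ i))"
      by (simp add: m_def pcompose_sum pm)
    also have "\<dots> = (\<Sum>i\<le>degree P. smult (u (f i)) (w ^ i)) - (\<Sum>i\<le>degree P. smult (u (f i)) (f i))"
      using u(2) by (simp add: sum.reindex[OF True])
    also have "\<dots> = (\<Sum>i\<le>degree P. smult (u (f i)) (w ^ i - f i))"
      by (simp add: smult_diff_right sum_subtractf)
    also have "P dvd \<dots>"
      by (intro dvd_sum dvd_smult) (simp add: f_def minus_mod_eq_mult_div)
    finally have "P dvd pcompose m w" .
    then show thesis using \<open>m \<noteq> 0\<close> that by blast
  qed
qed

lemma derivation_map_poly_pCons:
  "derivation D \<Longrightarrow> map_poly D (pCons a p) = pCons (D a) (map_poly D p)"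
  by (intro poly_eqI) (simp add: coeff_map_poly derivation_0 coeff_pCons split: nat.split)

lemma derivation_pcompose:
  assumes D: "derivation D"
  shows "map_poly D (pcompose m w) = pcompose (map_poly D m) w + pcompose (pderiv m) w * map_poly D w"
proof (induction m)
  case (pCons a m)
  note E = derivation_map_poly[OF D]
  show ?case
    by (simp add: pcompose_pCons derivation_add[OF E] derivation_mult[OF E] pCons.IH
        derivation_map_poly_pCons[OF D] pderiv_pCons pcompose_add algebra_simps)
qed simp

lemma pderiv_surj:
  fixes p :: "'l::field_char_0 poly"
  obtains q where "pderiv q = p"
proof -
  have "pderiv (\<Sum>i\<le>degree p. monom (coeff p i / of_nat (Suc i)) (Suc i)) = (\<Sum>i\<le>degree p. monom (coeff p i) i)"
    by (simp add: pderiv_sum pderiv_monom del: of_nat_Suc)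
  then show thesis using that poly_as_sum_of_monoms[of p] by metis
qed

lemma fraction_embedding_to_fract:
  "fraction_embedding (to_fract :: 'l::field_char_0 poly \<Rightarrow> 'l poly fract)"
proof
  fix x :: "'l poly fract"
  show "\<exists>a b. b \<noteq> 0 \<and> x = to_fract a / to_fract b"
    by (cases x) (auto simp: Fract_conv_to_fract)
next
  fix k :: nat assume "k > 0"
  then show "(of_nat k :: 'l poly) dvd 1" by (simp add: of_nat_poly is_unit_pCons_iff)
qed

text \<open>Makes \<open>pole_order_derivation\<close> available for the last variable at every
  prime of L[t].\<close>

lemma not_dvd_pderiv_prime:
  fixes P :: "'l::field_char_0 poly"
  assumes "prime_elem P"
  shows "degree P > 0" "\<not> P dvd pderiv P"
proof -
  show "degree P > 0"
    using assms by (auto simp: prime_elem_def is_unit_iff_degree)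
  then show "\<not> P dvd pderiv P" by (intro not_dvd_pderiv) auto
qed

section \<open>Differential fields and integration of closed forms\<close>

definition closed_form :: "nat \<Rightarrow> (nat \<Rightarrow> 'l \<Rightarrow> 'l) \<Rightarrow> (nat \<Rightarrow> 'l) \<Rightarrow> bool" where
  "closed_form n D \<eta> \<longleftrightarrow> (\<forall>i<n. \<forall>j<n. D i (\<eta> j) = D j (\<eta> i))"

text \<open>The forms da plus a finite sum of terms c dg/g with constant c. The inductive shape lets
  terms accumulate while a form is being reduced. Forms are functions on all of \<open>nat\<close>,
  so equality is demanded only for the indices below \<open>n\<close>.\<close>

inductive log_exact :: "nat \<Rightarrow> (nat \<Rightarrow> 'l::field \<Rightarrow> 'l) \<Rightarrow> ('k \<Rightarrow> 'l) \<Rightarrow> (nat \<Rightarrow> 'l) \<Rightarrow> bool" for n D iota where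
  exact: "(\<And>i. i < n \<Longrightarrow> \<eta> i = D i a) \<Longrightarrow> log_exact n D iota \<eta>"
| log: "log_exact n D iota \<eta> \<Longrightarrow> g \<noteq> 0 \<Longrightarrow> (\<And>i. i < n \<Longrightarrow> \<theta> i = \<eta> i + iota c * (D i g / g))
    \<Longrightarrow> log_exact n D iota \<theta>"

definition extend_der :: "nat \<Rightarrow> (nat \<Rightarrow> 'l::field \<Rightarrow> 'l) \<Rightarrow> nat \<Rightarrow> 'l poly fract \<Rightarrow> 'l poly fract" where
  "extend_der n D i = (if i < n then frac_der (map_poly (D i)) else frac_der pderiv)"

definition const_fract :: "'l::field \<Rightarrow> 'l poly fract" where
  "const_fract c = to_fract [:c:]"

lemma const_fract_simps:
  "const_fract 0 = 0" "const_fract 1 = 1" "const_fract (x + y) = const_fract x + const_fract y"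
  "const_fract (x * y) = const_fract x * const_fract y"
  "const_fract x = const_fract y \<longleftrightarrow> x = y" "const_fract x = 0 \<longleftrightarrow> x = 0"
  by (auto simp: const_fract_def simp flip: to_fract_add to_fract_mult)

lemma const_fract_divide: "const_fract (x / y) = const_fract x / const_fract y"
proof (cases "y = 0")
  case False
  then have "const_fract (x / y) * const_fract y = const_fract x" by (simp flip: const_fract_simps(4))
  then show ?thesis using False by (simp add: const_fract_simps field_simps)
qed (simp add: const_fract_simps)

text \<open>What is known about a level of the tower before a variable is added. By
  \<open>const\<close>, an element killed by all derivations lies in the image of K;
  \<open>constant_mod_prime\<close> applies this to the coefficients of a minimal polynomial, which
  then splits because K is algebraically closed.\<close>

locale diff_field = inj_idom_hom iota for iota :: "'k::alg_closed_field \<Rightarrow> 'l::field_char_0" +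
  fixes n :: nat and D :: "nat \<Rightarrow> 'l \<Rightarrow> 'l"
  assumes der: "i < n \<Longrightarrow> derivation (D i)"
    and comm: "i < n \<Longrightarrow> j < n \<Longrightarrow> D i (D j x) = D j (D i x)"
    and const: "(\<forall>i<n. D i x = 0) \<longleftrightarrow> x \<in> range iota"
begin

lemma D_iota: "i < n \<Longrightarrow> D i (iota c) = 0"
  using const[of "iota c"] by auto

text \<open>The exact term is pushed through the logarithmic steps into the base case.\<close>

lemma log_exact_add_exact:
  assumes "log_exact n D iota \<eta>" "\<And>i. i < n \<Longrightarrow> \<theta> i = \<eta> i + D i a"
  shows "log_exact n D iota \<theta>"
  using assms
proof (induction arbitrary: \<theta>)
  case (exact \<eta> b)
  show ?case
    by (rule log_exact.exact[of n _ _ "b + a"]) (simp add: exact derivation_add[OF der])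
next
  case (log \<eta> g \<theta>' c)
  show ?case
  proof (rule log_exact.log)
    show "log_exact n D iota (\<lambda>i. \<eta> i + D i a)" by (rule log.IH) simp
    show "g \<noteq> 0" by fact
    show "\<theta> i = \<eta> i + D i a + iota c * (D i g / g)" if "i < n" for i
      using log.hyps(3)[OF that] log.prems[OF that] by simp
  qed
qed

lemma closed_form_diff_exact:
  assumes "closed_form n D \<eta>"
  shows "closed_form n D (\<lambda>i. \<eta> i - D i a)"
  using assms by (auto simp: closed_form_def derivation_diff[OF der] comm[of _ _ a])

lemma closed_form_diff_log:
  assumes "closed_form n D \<eta>" "g \<noteq> 0"
  shows "closed_form n D (\<lambda>i. \<eta> i - iota c * (D i g / g))"
proof -
  have "D i (D j g / g) = D j (D i g / g)" if "i < n" "j < n" for i j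
    using that assms(2) by (simp add: derivation_divide[OF der] comm[of i j g])
  moreover have "D i (\<eta> j - iota c * (D j g / g)) = D i (\<eta> j) - iota c * D i (D j g / g)" if "i < n" for i j
    using that by (simp add: derivation_diff[OF der] derivation_mult[OF der] D_iota del: times_divide_eq_right)
  ultimately show ?thesis
    using assms(1) by (simp add: closed_form_def del: times_divide_eq_right)
qed

text \<open>The hypothesis says that the class of \<open>w\<close> in the residue field of \<open>P\<close> is annihilated by the induced
  derivations. Applying them to its monic minimal polynomial gives relations of lower degree, so
  the coefficients of that polynomial are constants and it splits.\<close>

lemma constant_mod_prime:
  assumes P: "prime_elem P"
    and dvd: "\<And>i. i < n \<Longrightarrow> P dvd pderiv P * map_poly (D i) w - pderiv w * map_poly (D i) P"
  shows "\<exists>c. P dvd w - [:iota c:]"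
proof -
  note degP = not_dvd_pderiv_prime(1)[OF P]
  define I where "I = {m. m \<noteq> 0 \<and> P dvd pcompose m w}"
  obtain m1 where "m1 \<in> I" using algebraic_relation_mod[OF degP, of w] unfolding I_def by blast
  then obtain m0 where m0: "m0 \<in> I" and min: "\<And>z. z \<in> I \<Longrightarrow> degree m0 \<le> degree z"
    using ex_has_least_nat[of "\<lambda>z. z \<in> I" m1 degree] by blast
  define m where "m = smult (inverse (lead_coeff m0)) m0"
  have m: "m \<noteq> 0" "P dvd pcompose m w" "lead_coeff m = 1" "degree m = degree m0"
    using m0 by (auto simp: I_def m_def pcompose_smult dvd_smult)
  have "map_poly (D i) m = 0" if i: "i < n" for i
  proof (rule ccontr)
    assume nz: "map_poly (D i) m \<noteq> 0"
    note E = derivation_map_poly[OF der[OF i]]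
    \<comment> \<open>On L[t] modulo \<open>P\<close> this is \<open>pderiv P\<close> times the
      unique extension of \<open>D i\<close> to the residue field. It sends \<open>P\<close> to 0,
      hence multiples of \<open>P\<close> to multiples of \<open>P\<close>, and the factor
      \<open>pderiv P\<close> avoids a division.\<close>
    define \<delta> where "\<delta> w = pderiv P * map_poly (D i) w - pderiv w * map_poly (D i) P" for w
    have "\<delta> (pcompose m w) = pcompose (pderiv m) w * \<delta> w + pderiv P * pcompose (map_poly (D i) m) w"
      by (simp add: \<delta>_def derivation_pcompose[OF der[OF i]] pderiv_pcompose algebra_simps)
    moreover have "P dvd \<delta> (pcompose m w)"
    proof -
      obtain u where u: "pcompose m w = P * u" using m(2) by (elim dvdE)
      have "\<delta> (P * u) = P * \<delta> u" by (simp add: \<delta>_def derivation_mult[OF E] pderiv_mult algebra_simps)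
      then show ?thesis using u by simp
    qed
    moreover have "P dvd \<delta> w" unfolding \<delta>_def by (rule dvd[OF i])
    ultimately have "P dvd pderiv P * pcompose (map_poly (D i) m) w"
      by (metis dvd_add_right_iff dvd_mult)
    then have "P dvd pcompose (map_poly (D i) m) w"
      using not_dvd_pderiv_prime(2)[OF P] prime_elem_dvd_mult_iff[OF P] by blast
    with nz have "degree m0 \<le> degree (map_poly (D i) m)" by (intro min) (simp add: I_def)
    moreover have "degree (map_poly (D i) m) \<le> degree m" by (rule degree_map_poly_le)
    ultimately have "degree (map_poly (D i) m) = degree m" using m(4) by simp
    then have "lead_coeff (map_poly (D i) m) = D i (lead_coeff m)"
      by (simp add: coeff_map_poly derivation_0[OF der[OF i]])
    then show False using nz m(3) by (simp add: derivation_1[OF der[OF i]])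
  qed
  then have "D i (coeff m j) = 0" if "i < n" for i j
    using that coeff_map_poly[of "D i" m j] by (simp add: derivation_0[OF der])
  then have "\<exists>c. coeff m j = iota c" for j
    using const[of "coeff m j"] by auto
  then have "\<forall>j. \<exists>c. coeff m j = iota c" ..
  from choice[OF this] obtain g where g: "\<forall>j. coeff m j = iota (g j)" ..
  define q where "q = poly_of_list (map g [0..<Suc (degree m)])"
  have g0: "g j = 0" if "degree m < j" for j
    using g[rule_format, of j] coeff_eq_0[OF that] by simp
  have mq: "m = map_poly iota q"
  proof (rule poly_eqI)
    fix j
    show "coeff m j = coeff (map_poly iota q) j"
      by (cases "j \<le> degree m") (auto simp: q_def coeff_map_poly nth_default_def g g0 simp del: upt_Suc)
  qed
  have degm: "degree m > 0"
  proof (rule ccontr)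
    assume "\<not> degree m > 0"
    then have "m = 1" using m(3) by (metis degree_eq_zeroE gr0I lead_coeff_pCons(2) one_pCons)
    then show False using m(2) degP by (auto simp: is_unit_iff_degree pcompose_1)
  qed
  then have "degree q > 0" using mq by simp
  from alg_closed_imp_poly_has_root[OF this] obtain c where "poly q c = 0" by blast
  then obtain q1 where q1: "q = [:- c, 1:] * q1" by (auto simp: poly_eq_0_iff_dvd elim: dvdE)
  define m2 where "m2 = map_poly iota q1"
  have m2: "m = [:- iota c, 1:] * m2"
    unfolding mq q1 m2_def
    by (intro poly_eqI) (simp add: coeff_map_poly coeff_pCons hom_add hom_minus hom_mult hom_uminus split: nat.split)
  have m20: "m2 \<noteq> 0" using m2 m(1) by auto
  have "degree m = Suc (degree m2)" using m20 unfolding m2 by (subst degree_mult_eq) auto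
  \<comment> \<open>By minimality the cofactor \<open>m2\<close> of the root does not vanish at the
    class of \<open>w\<close>, so primality of \<open>P\<close> leaves only the linear
    factor.\<close>
  then have "m2 \<notin> I" using min[of m2] m(4) by auto
  then have "\<not> P dvd pcompose m2 w" using m20 by (simp add: I_def)
  moreover have "pcompose m w = (w - [:iota c:]) * pcompose m2 w"
    unfolding m2 pcompose_mult by (simp add: pcompose_pCons)
  ultimately have "P dvd w - [:iota c:]" using m(2) prime_elem_dvd_mult_iff[OF P] by metis
  then show ?thesis by blast
qed

definition "D' = extend_der n D"
definition "iota' c = const_fract (iota c)"

sublocale frac: fraction_embedding "to_fract :: 'l poly \<Rightarrow> 'l poly fract"
  by (rule fraction_embedding_to_fract)

lemma D'_to_fract:
  "i < n \<Longrightarrow> D' i (to_fract w) = to_fract (map_poly (D i) w)"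
  "D' n (to_fract w) = to_fract (pderiv w)"
  by (auto simp: D'_def extend_der_def frac_der_to_fract derivation_map_poly derivation_pderiv der)

lemma der': "i < Suc n \<Longrightarrow> derivation (D' i)"
  by (auto simp: D'_def extend_der_def derivation_frac_der derivation_map_poly derivation_pderiv der)

lemma comm': "i < Suc n \<Longrightarrow> j < Suc n \<Longrightarrow> D' i (D' j x) = D' j (D' i x)"
  by (cases "i < n"; cases "j < n")
    (auto simp: D'_def extend_der_def derivation_map_poly derivation_pderiv der
      map_poly_pderiv_commute map_poly_commute comm intro!: frac_der_commute)

lemma D'_const_fract:
  "i < n \<Longrightarrow> D' i (const_fract c) = const_fract (D i c)"
  "D' n (const_fract c) = 0"
  by (auto simp: const_fract_def D'_to_fract derivation_map_poly_pCons der pderiv_pCons)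

text \<open>An element of L(t) with zero t-derivative has no poles, because differentiation would
  raise their order; so it is a polynomial, and a constant one in characteristic 0.\<close>

lemma D'_n_eq_0:
  assumes "D' n x = 0"
  shows "\<exists>c. x = const_fract c"
proof -
  have "regular_at to_fract P x" if P: "prime_elem P" for P
    using frac.pole_order_derivation[OF P der'[of n] D'_to_fract(2) not_dvd_pderiv_prime(2)[OF P], of 0 x]
      frac.reg_emb[OF P, of 0] by (simp add: assms)
  from frac.emb_if_regular[OF this] obtain a where a: "x = to_fract a" by blast
  then have "pderiv a = 0" using assms by (simp add: D'_to_fract)
  then obtain c where "a = [:c:]" using pderiv_iszero by blast
  then show ?thesis using a by (auto simp: const_fract_def)
qed

lemma diff_field_extend: "diff_field iota' (Suc n) D'"
proof
  show "iota' 0 = 0" "iota' 1 = 1" "iota' (x + y) = iota' x + iota' y" "iota' (x * y) = iota' x * iota' y" for x y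
    by (simp_all add: iota'_def const_fract_simps hom_add hom_mult)
  show "x = 0" if "iota' x = 0" for x
    using that by (simp add: iota'_def const_fract_simps)
  show "(\<forall>i<Suc n. D' i x = 0) \<longleftrightarrow> x \<in> range iota'" for x
  proof
    assume *: "\<forall>i<Suc n. D' i x = 0"
    then obtain c where c: "x = const_fract c" using D'_n_eq_0[of x] by auto
    with * have "\<forall>i<n. D i c = 0" by (auto simp: D'_const_fract const_fract_simps less_Suc_eq)
    then show "x \<in> range iota'" using const c by (auto simp: iota'_def)
  next
    assume "x \<in> range iota'"
    then show "\<forall>i<Suc n. D' i x = 0"
      using D_iota by (auto simp: iota'_def D'_const_fract less_Suc_eq const_fract_simps)
  qed
qed (auto intro: der' comm')

lemma log_exact_lift:
  assumes "log_exact n D iota \<theta>" "\<And>i. i < n \<Longrightarrow> \<eta> i = const_fract (\<theta> i)" "\<eta> n = 0"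
  shows "log_exact (Suc n) D' iota' \<eta>"
  using assms
proof (induction arbitrary: \<eta>)
  case (exact \<theta> a)
  show ?case
    by (rule log_exact.exact[of _ _ _ "const_fract a"]) (use exact in \<open>auto simp: less_Suc_eq D'_const_fract\<close>)
next
  case (log \<theta>0 g \<theta> c)
  define \<eta>0 where "\<eta>0 i = (if i < n then const_fract (\<theta>0 i) else 0)" for i
  show ?case
  proof (rule log_exact.log)
    show "log_exact (Suc n) D' iota' \<eta>0" by (rule log.IH) (auto simp: \<eta>0_def)
    show "const_fract g \<noteq> 0" using log.hyps by (simp add: const_fract_simps)
    show "\<eta> i = \<eta>0 i + iota' c * (D' i (const_fract g) / const_fract g)" if "i < Suc n" for i
      using that log.hyps(3) log.prems
      by (auto simp: less_Suc_eq \<eta>0_def iota'_def D'_const_fract const_fract_simps const_fract_divide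
            simp del: times_divide_eq_right)
  qed
qed

text \<open>The residue along \<open>P\<close> is the class of some polynomial \<open>w\<close>
  modulo \<open>P\<close>. Closedness shows that the derivations induced on the residue field
  annihilate it, so \<open>constant_mod_prime\<close> applies, and replacing \<open>w\<close> by the
  constant changes the last component only by a regular term.\<close>

lemma residue_constant:
  assumes closed: "closed_form (Suc n) D' \<eta>" and P: "prime_elem P"
    and reg: "regular_at to_fract P (to_fract P * \<eta> n)"
  shows "\<exists>c. regular_at to_fract P (\<eta> n - iota' c * (to_fract (pderiv P) / to_fract P))"
proof -
  define e where "e = (to_fract :: 'l poly \<Rightarrow> _)"
  note e = frac.emb_simps[folded e_def]
  have P0: "e P \<noteq> 0" using prime_elem_not_zeroI[OF P] by (simp add: e_def)
  have P': "\<not> P dvd pderiv P" by (rule not_dvd_pderiv_prime[OF P])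
  obtain a b where b: "\<not> P dvd b" and ab: "e P * \<eta> n * e b = e a"
    using reg unfolding e_def by (rule regular_atE)
  have "\<not> P dvd b * pderiv P" using b P' prime_elem_dvd_mult_iff[OF P] by blast
  then obtain v where "P dvd v * (b * pderiv P) - 1" using inverse_mod_prime[OF P] by blast
  then obtain t where t: "v * (b * pderiv P) - 1 = P * t" by (elim dvdE)
  \<comment> \<open>As \<open>v\<close> inverts \<open>b * pderiv P\<close> modulo \<open>P\<close>,
    this \<open>w\<close> represents the residue: \<open>w * pderiv P / P\<close> has the same polar
    part along \<open>P\<close> as the last component, leaving the regular remainder
    \<open>x\<close>.\<close>
  define w where "w = a * v"
  define x where "x = \<eta> n - e (w * pderiv P) / e P"
  have \<eta>n: "\<eta> n = e (w * pderiv P) / e P + x" by (simp add: x_def)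
  have "e P * x = e P * \<eta> n - e (w * pderiv P)"
    using P0 by (simp add: x_def right_diff_distrib)
  then have "e P * (x * e b) = e P * \<eta> n * e b - e (w * pderiv P) * e b"
    by (metis left_diff_distrib mult.assoc)
  also have "\<dots> = - e (a * (v * (b * pderiv P) - 1))"
    unfolding ab w_def e(1)[symmetric] e(4)[symmetric] e(3)[symmetric] by (simp add: algebra_simps)
  also have "\<dots> = e P * e (- a * t)"
    unfolding t e(3)[symmetric] e(1)[symmetric] by (simp add: algebra_simps)
  finally have "x * e b = e (- a * t)" using P0 by simp
  then have x: "regular_at e P x" using b by (intro regular_atI)
  have dvd: "P dvd pderiv P * map_poly (D i) w - pderiv w * map_poly (D i) P" if i: "i < n" for i
  proof -
    let ?E = "map_poly (D i)"
    let ?num = "pderiv P * ?E w - pderiv w * ?E P"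
    note di = der'[OF less_SucI[OF i]] and dn = der'[OF lessI]
    note Dei = D'_to_fract(1)[OF i, folded e_def] and Den = D'_to_fract(2)[folded e_def]
    define y where "y = \<eta> i - e (w * ?E P) / e P"
    have "D' n (\<eta> i) = D' i (\<eta> n)" using closed i by (auto simp: closed_form_def)
    then have "D' n y = D' i (e (w * pderiv P) / e P) - D' n (e (w * ?E P) / e P) + D' i x"
      unfolding y_def derivation_diff[OF dn] by (simp add: \<eta>n derivation_add[OF di])
    also have "D' i (e (w * pderiv P) / e P) - D' n (e (w * ?E P) / e P) = e ?num / e P"
    proof -
      have "?E (w * pderiv P) * P - w * pderiv P * ?E P - (pderiv (w * ?E P) * P - w * ?E P * pderiv P) = P * ?num"
        by (simp add: derivation_mult[OF derivation_map_poly[OF der[OF i]]] pderiv_mult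
            map_poly_pderiv_commute[OF der[OF i]] algebra_simps)
      note id = this
      show ?thesis
        unfolding derivation_divide[OF di P0] derivation_divide[OF dn P0] Dei Den
          e(1)[symmetric] e(4)[symmetric] diff_divide_distrib[symmetric] id
        using P0 by (simp add: e(1))
    qed
    finally have y: "D' n y = e ?num / e P + D' i x" .
    note rd = frac.reg_derivation[OF P, folded e_def]
    have Dx: "regular_at e P (D' i x)" by (rule rd[OF di Dei x])
    have "e P * D' n y = e ?num + e P * D' i x" using P0 by (simp add: y distrib_left)
    moreover have "regular_at e P (e ?num + e P * D' i x)"
      unfolding e_def
      by (rule frac.reg_add[OF P frac.reg_emb[OF P] frac.reg_mult[OF P frac.reg_emb[OF P] Dx[unfolded e_def]]])
    ultimately have "regular_at e P (e P ^ Suc 0 * D' n y)" by simp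
    then have "regular_at e P (e P ^ 0 * y)"
      by (rule frac.pole_order_derivation[folded e_def, OF P dn Den P'])
    then have "regular_at e P y" by simp
    then have "regular_at e P (D' n y)" by (rule rd[OF dn Den])
    from frac.reg_diff[OF P this[unfolded e_def] Dx[unfolded e_def]]
    have "regular_at to_fract P (to_fract ?num / to_fract P)" by (simp add: y e_def)
    then show ?thesis by (rule frac.dvd_of_reg[OF P])
  qed
  from constant_mod_prime[OF P dvd] obtain c where "P dvd w - [:iota c:]" by blast
  then obtain s where s: "w - [:iota c:] = P * s" by (elim dvdE)
  have "iota' c = e [:iota c:]" by (simp add: iota'_def const_fract_def e_def)
  also have "[:iota c:] = w - P * s" by (simp flip: s)
  finally have ic: "iota' c = e w - e P * e s" by (simp only: e(1,4))
  have "iota' c * e (pderiv P) = e (w * pderiv P) - e P * e (s * pderiv P)"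
    unfolding ic by (simp add: e(1) algebra_simps)
  then have "iota' c * (e (pderiv P) / e P) = e (w * pderiv P) / e P - e (s * pderiv P)"
    using P0 by (simp add: diff_divide_distrib)
  then have "\<eta> n - iota' c * (e (pderiv P) / e P) = e (s * pderiv P) + x"
    by (simp add: \<eta>n)
  moreover have "regular_at e P (e (s * pderiv P) + x)"
    unfolding e_def by (rule frac.reg_add[OF P frac.reg_emb[OF P] x[unfolded e_def]])
  ultimately have "regular_at e P (\<eta> n - iota' c * (e (pderiv P) / e P))" by simp
  then show ?thesis unfolding e_def by (rule exI)
qed

text \<open>Induction on the degree of the denominator of the last component: a multiple prime factor is
  removed by subtracting an exact form, a simple one by subtracting a logarithmic form.\<close>

lemma closed_imp_log_exact_aux:
  assumes prim: "\<And>\<theta>. closed_form n D \<theta> \<Longrightarrow> log_exact n D iota \<theta>"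
    and "F \<noteq> 0" "\<eta> n = to_fract N / to_fract F" "closed_form (Suc n) D' \<eta>"
  shows "log_exact (Suc n) D' iota' \<eta>"
  using assms(2-)
proof (induction "degree F" arbitrary: F N \<eta> rule: less_induct)
  case less
  interpret ext: diff_field iota' "Suc n" D' by (rule diff_field_extend)
  note dn = der'[OF lessI]
  have diff_ex: "log_exact (Suc n) D' iota' \<eta>"
    if "log_exact (Suc n) D' iota' (\<lambda>i. \<eta> i - D' i a)" for a
    by (rule ext.log_exact_add_exact[OF that]) simp
  show ?case
  proof (cases "F dvd 1")
    \<comment> \<open>With a unit denominator the last component is a polynomial and has a
      polynomial primitive. Once it is removed, closedness makes the other components independent of
      the last variable, and integrability one level below applies.\<close>
    case True
    then obtain G where G: "1 = F * G" by (elim dvdE)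
    then have "to_fract F * to_fract G = (1 :: 'l poly fract)" by (simp flip: to_fract_mult)
    then have "\<eta> n = to_fract (N * G)"
      using less.prems by (simp add: divide_inverse inverse_unique)
    moreover obtain B where "pderiv B = N * G" by (rule pderiv_surj)
    ultimately have \<eta>n: "\<eta> n = D' n (to_fract B)" by (simp add: D'_to_fract)
    define \<theta> where "\<theta> i = \<eta> i - D' i (to_fract B)" for i
    have cl: "closed_form (Suc n) D' \<theta>"
      unfolding \<theta>_def by (rule ext.closed_form_diff_exact) fact
    have \<theta>n: "\<theta> n = 0" by (simp add: \<theta>_def \<eta>n)
    have "\<exists>c. \<theta> i = const_fract c" if "i < n" for i
    proof (rule D'_n_eq_0)
      have "D' n (\<theta> i) = D' i (\<theta> n)" using cl that by (simp add: closed_form_def)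
      then show "D' n (\<theta> i) = 0" using that by (simp add: \<theta>n derivation_0[OF der'])
    qed
    then have "\<forall>i. \<exists>c. i < n \<longrightarrow> \<theta> i = const_fract c" by simp
    from choice[OF this] obtain l where l: "\<forall>i. i < n \<longrightarrow> \<theta> i = const_fract (l i)" ..
    have "closed_form n D l"
      unfolding closed_form_def
    proof (intro allI impI)
      fix i j assume ij: "i < n" "j < n"
      then have "D' i (\<theta> j) = D' j (\<theta> i)" using cl by (simp add: closed_form_def)
      then show "D i (l j) = D j (l i)" using ij l by (simp add: D'_const_fract const_fract_simps)
    qed
    from log_exact_lift[OF prim[OF this], of \<theta>] l \<theta>n have "log_exact (Suc n) D' iota' \<theta>" by simp
    then show ?thesis using diff_ex unfolding \<theta>_def by blast
  next
    case False
    obtain Fs where "mset_factors Fs F" using mset_factors_exist[OF less.prems(1) False] ..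
    then have Fs: "Fs \<noteq> {#}" "prod_mset Fs = F" "\<And>q. q \<in># Fs \<Longrightarrow> irreducible q"
      by (auto dest: mset_factorsD)
    then obtain P where "P \<in># Fs" by auto
    then have PF: "P dvd F" and P: "prime_elem P" using Fs dvd_prod_mset[of P Fs] by auto
    obtain k g where F: "F = P ^ k * g" and Pg: "\<not> P dvd g"
      using prime_power_decomposition[OF P less.prems(1)] .
    note degP = not_dvd_pderiv_prime(1)[OF P] and P' = not_dvd_pderiv_prime(2)[OF P]
    have g0: "g \<noteq> 0" and P0: "P \<noteq> 0" using Pg prime_elem_not_zeroI[OF P] by auto
    have k: "k \<noteq> 0" using F Pg PF by (intro notI) simp
    show ?thesis
    proof (cases "k = 1")
      case True
      then have "\<eta> n = to_fract N / (to_fract P * to_fract g)" using less.prems F by simp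
      then have \<eta>n: "to_fract P * \<eta> n = to_fract N / to_fract g" using P0 by simp
      have "regular_at to_fract P (to_fract P * \<eta> n)"
        unfolding \<eta>n by (rule frac.reg_div_emb[OF P Pg])
      from residue_constant[OF less.prems(3) P this] obtain c where
        c: "regular_at to_fract P (\<eta> n - iota' c * (to_fract (pderiv P) / to_fract P))" ..
      define \<theta> where "\<theta> i = \<eta> i - iota' c * (D' i (to_fract P) / to_fract P)" for i
      have cl: "closed_form (Suc n) D' \<theta>"
        unfolding \<theta>_def using P0 by (intro ext.closed_form_diff_log less.prems) simp
      \<comment> \<open>The last component of the new form is \<open>M / (P * g)\<close>. Its
        regularity at \<open>P\<close> forces \<open>P\<close> to divide \<open>M\<close>, so the
        denominator shrinks to \<open>g\<close>.\<close>
      define M where "M = N - [:iota c:] * pderiv P * g"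
      have \<theta>n: "\<theta> n * to_fract g = to_fract M / to_fract P"
      proof -
        have "\<theta> n * to_fract g * to_fract P
            = (to_fract P * \<eta> n) * to_fract g - iota' c * to_fract (pderiv P) * to_fract g"
          using P0 by (simp add: \<theta>_def D'_to_fract left_diff_distrib)
        also have "\<dots> = to_fract M"
          unfolding \<eta>n M_def iota'_def const_fract_def to_fract_diff to_fract_mult using g0 by simp
        finally show ?thesis using P0 by (simp add: eq_divide_eq)
      qed
      have "regular_at to_fract P (\<theta> n * to_fract g)"
        using c by (intro frac.reg_mult[OF P _ frac.reg_emb[OF P]]) (simp add: \<theta>_def D'_to_fract)
      then have "P dvd M" unfolding \<theta>n by (rule frac.dvd_of_reg[OF P])
      then obtain M' where "M = P * M'" by (elim dvdE)
      then have "\<theta> n * to_fract g = to_fract M'" using \<theta>n P0 by simp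
      then have "\<theta> n = to_fract M' / to_fract g" using g0 by (simp add: eq_divide_eq)
      moreover have "degree g < degree F"
        using F True P0 g0 degP by (simp add: degree_mult_eq)
      ultimately have "log_exact (Suc n) D' iota' \<theta>" using less.hyps g0 cl by blast
      then show ?thesis
        by (rule log_exact.log[of _ _ _ _ "to_fract P" _ c]) (use P0 in \<open>simp_all add: \<theta>_def\<close>)
    next
      case False
      then obtain m where m: "k = Suc (Suc m)" using k by (metis One_nat_def not0_implies_Suc)
      define s where "s = (of_nat (Suc m) :: 'l poly)"
      have "\<not> P dvd s"
        using frac.of_nat_unit[of "Suc m"] prime_elem_not_unit[OF P] dvd_trans unfolding s_def by blast
      then have "\<not> P dvd s * pderiv P * g" using P' Pg prime_elem_dvd_mult_iff[OF P] by blast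
      then obtain v where "P dvd v * (s * pderiv P * g) - 1" using inverse_mod_prime[OF P] by blast
      then obtain t where t: "v * (s * pderiv P * g) - 1 = P * t" by (elim dvdE)
      \<comment> \<open>Hermite reduction. The derivative of \<open>B / P ^ (m + 1)\<close> is
        \<open>(pderiv B * P - s * B * pderiv P) / P ^ (m + 2)\<close>; for it to match the leading
        polar part, \<open>B\<close> must be the quotient of \<open>N\<close> by
        \<open>- s * pderiv P * g\<close> modulo \<open>P\<close>, and \<open>v\<close> inverts
        \<open>s * pderiv P * g\<close>.\<close>
      define B where "B = - N * v"
      define a where "a = to_fract B / to_fract (P ^ Suc m)"
      define M where "M = - N * t - pderiv B * g"
      have key: "N - (pderiv B * P - s * B * pderiv P) * g = P * M"
      proof -
        have "N - (pderiv B * P - s * B * pderiv P) * g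
            = - N * (v * (s * pderiv P * g) - 1) - pderiv B * g * P"
          by (simp add: B_def algebra_simps)
        also have "\<dots> = P * M" unfolding t by (simp add: M_def algebra_simps)
        finally show ?thesis .
      qed
      have "D' n a = (to_fract (pderiv B) * to_fract (P ^ Suc m) - to_fract B * to_fract (pderiv (P ^ Suc m)))
          / (to_fract (P ^ Suc m) * to_fract (P ^ Suc m))"
        using derivation_divide[OF dn, of "to_fract (P ^ Suc m)" "to_fract B"] P0
        unfolding a_def D'_to_fract(2) by (simp del: power_Suc to_fract_mult)
      also have "\<dots> = to_fract (P ^ m * (pderiv B * P - s * B * pderiv P)) / to_fract (P ^ m * (P ^ Suc (Suc m)))"
      proof -
        have "pderiv (P ^ Suc m) = s * P ^ m * pderiv P"
          unfolding s_def by (rule derivation_power_Suc[OF derivation_pderiv])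
        then have 1: "pderiv B * P ^ Suc m - B * pderiv (P ^ Suc m) = P ^ m * (pderiv B * P - s * B * pderiv P)"
          by (simp add: algebra_simps)
        have 2: "P ^ Suc m * P ^ Suc m = P ^ m * P ^ Suc (Suc m)"
          by (simp flip: power_add)
        show ?thesis unfolding to_fract_mult[symmetric] to_fract_diff[symmetric] 1 2 ..
      qed
      also have "\<dots> = to_fract (pderiv B * P - s * B * pderiv P) / to_fract (P ^ Suc (Suc m))"
        unfolding to_fract_mult[of "P ^ m"] using P0 by (intro mult_divide_mult_cancel_left) simp
      finally have Da: "D' n a = to_fract (pderiv B * P - s * B * pderiv P) / to_fract (P ^ k)"
        unfolding m .
      define \<theta> where "\<theta> i = \<eta> i - D' i a" for i
      have cl: "closed_form (Suc n) D' \<theta>"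
        unfolding \<theta>_def by (rule ext.closed_form_diff_exact) fact
      have "\<theta> n = to_fract N / to_fract F - to_fract ((pderiv B * P - s * B * pderiv P) * g) / to_fract F"
        using g0 by (simp add: \<theta>_def Da less.prems F del: to_fract_diff)
      also have "\<dots> = to_fract (P * M) / to_fract F"
        unfolding diff_divide_distrib[symmetric] to_fract_diff[symmetric] key ..
      also have "\<dots> = to_fract M / to_fract (P ^ Suc m * g)"
        using P0 by (simp add: F m)
      finally have "\<theta> n = to_fract M / to_fract (P ^ Suc m * g)" .
      moreover have "degree (P ^ Suc m * g) < degree F"
        unfolding F m using P0 g0 degP by (simp add: degree_mult_eq degree_power_eq)
      moreover have "P ^ Suc m * g \<noteq> 0" using P0 g0 by simp
      ultimately have "log_exact (Suc n) D' iota' \<theta>" using less.hyps cl by blast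
      then show ?thesis using diff_ex unfolding \<theta>_def by blast
    qed
  qed
qed

lemma closed_imp_log_exact_extend:
  assumes prim: "\<And>\<theta>. closed_form n D \<theta> \<Longrightarrow> log_exact n D iota \<theta>"
    and "closed_form (Suc n) D' \<eta>"
  shows "log_exact (Suc n) D' iota' \<eta>"
proof -
  obtain N F where "F \<noteq> 0" "\<eta> n = to_fract N / to_fract F" using frac.quot by blast
  with assms show ?thesis by (intro closed_imp_log_exact_aux)
qed

end

section \<open>The function field of three variables\<close>

definition lift_emb :: "('r::comm_ring_1 \<Rightarrow> 'l::field) \<Rightarrow> 'r poly \<Rightarrow> 'l poly fract" where
  "lift_emb e p = to_fract (map_poly e p)"

text \<open>Only the quotient property needs an argument: finitely many coefficients in L have a
  common denominator in R, so any polynomial over L becomes one over R after scaling.\<close>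

lemma fraction_embedding_lift_emb:
  assumes "fraction_embedding (e :: 'r::ufd \<Rightarrow> 'l::field)"
  shows "fraction_embedding (lift_emb e)"
proof -
  interpret e: fraction_embedding e by fact
  have mult: "map_poly e (p * q) = map_poly e p * map_poly e q" for p q
    by (intro poly_eqI) (simp add: coeff_map_poly coeff_mult e.hom_sum e.hom_mult)
  have const: "map_poly e [:c:] = [:e c:]" for c
    by (intro poly_eqI) (simp add: coeff_map_poly coeff_pCons split: nat.split)
  have clear: "\<exists>h a'. h \<noteq> 0 \<and> smult (e h) a = map_poly e a'" for a
  proof (induction a)
    case 0
    show ?case by (intro exI[of _ 1] exI[of _ 0]) simp
  next
    case (pCons c a)
    then obtain h a' where h: "h \<noteq> 0" "smult (e h) a = map_poly e a'" by blast
    obtain s t where st: "t \<noteq> 0" "c = e s / e t" using e.quot by blast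
    have "smult (e (h * t)) (pCons c a) = map_poly e (pCons (h * s) (smult t a'))"
    proof -
      have "smult (e (h * t)) a = smult (e t) (smult (e h) a)" by (simp add: e.hom_mult mult.commute)
      also have "\<dots> = map_poly e (smult t a')" unfolding h(2)
        by (intro poly_eqI) (simp add: coeff_map_poly e.hom_mult)
      finally have "smult (e (h * t)) a = map_poly e (smult t a')" .
      then show ?thesis using st h
        by (intro poly_eqI) (simp add: coeff_map_poly coeff_pCons e.hom_mult poly_eq_iff split: nat.split)
    qed
    then show ?case using h st by (intro exI[of _ "h * t"] exI) auto
  qed
  show ?thesis
  proof
    show "lift_emb e 0 = 0" "lift_emb e 1 = 1" by (simp_all add: lift_emb_def)
    show "lift_emb e (p + q) = lift_emb e p + lift_emb e q" for p q
      by (simp add: lift_emb_def e.map_poly_hom_add)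
    show "lift_emb e (p * q) = lift_emb e p * lift_emb e q" for p q
      by (simp add: lift_emb_def mult)
    show "p = 0" if "lift_emb e p = 0" for p
      using that by (simp add: lift_emb_def)
    show "(of_nat k :: 'r poly) dvd 1" if "k > 0" for k
      using e.of_nat_unit[OF that] by (simp add: of_nat_poly is_unit_const_poly_iff)
    show "\<exists>a b. b \<noteq> 0 \<and> x = lift_emb e a / lift_emb e b" for x
    proof -
      obtain a b where ab: "b \<noteq> 0" "x = to_fract a / to_fract b"
        by (cases x) (auto simp: Fract_conv_to_fract)
      obtain h a' where h: "h \<noteq> 0" "smult (e h) a = map_poly e a'" using clear by blast
      obtain k b' where k: "k \<noteq> 0" "smult (e k) b = map_poly e b'" using clear by blast
      have "map_poly e b' \<noteq> 0" unfolding k(2)[symmetric] using k(1) ab(1) by simp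
      then have b': "b' \<noteq> 0" by auto
      have eq: "to_fract (map_poly e [:k:]) * to_fract (map_poly e a') * to_fract b
          = to_fract a * (to_fract (map_poly e [:h:]) * to_fract (map_poly e b'))"
        unfolding h(2)[symmetric] k(2)[symmetric] to_fract_mult[symmetric]
        by (simp add: const ac_simps)
      have nz: "lift_emb e (smult h b') \<noteq> 0" using h b' by (simp add: lift_emb_def)
      have "x = lift_emb e ([:k:] * a') / lift_emb e ([:h:] * b')"
        using eq ab(1) nz unfolding lift_emb_def mult ab(2) to_fract_mult
        by (subst frac_eq_eq) (auto simp: lift_emb_def mult ac_simps)
      moreover have "[:h:] * b' \<noteq> 0" using h b' by simp
      ultimately show ?thesis by blast
    qed
  qed
qed

text \<open>The tower K, K(X), K(X)(Y), K(X)(Y)(Z), started from K with no derivations at all. Index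
  0 stands for X, index 1 for Y and index 2 for Z.\<close>

definition "der1 = diff_field.D' 0 (\<lambda>_ x. x :: 'a::{alg_closed_field, field_char_0})"
definition "const1 = diff_field.iota' (\<lambda>x. x :: 'a::{alg_closed_field, field_char_0})"
definition "der2 = diff_field.D' (Suc 0) der1"
definition "const2 = diff_field.iota' const1"

definition tower_der :: "nat \<Rightarrow> 'a::{alg_closed_field, field_char_0} poly fract poly fract poly fract \<Rightarrow> _" where
  "tower_der = diff_field.D' (Suc (Suc 0)) der2"

definition tower_const :: "'a::{alg_closed_field, field_char_0} \<Rightarrow> 'a poly fract poly fract poly fract" where
  "tower_const = diff_field.iota' const2"

lemma diff_field0: "diff_field (\<lambda>x. x :: 'a::{alg_closed_field, field_char_0}) 0 (\<lambda>_ x. x)"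
  by unfold_locales auto

lemmas diff_field1 = diff_field.diff_field_extend[OF diff_field0, folded der1_def const1_def]
lemmas diff_field2 = diff_field.diff_field_extend[OF diff_field1, folded der2_def const2_def]
lemmas diff_field3 = diff_field.diff_field_extend[OF diff_field2, folded tower_der_def tower_const_def]

definition emb3 :: "'a::{alg_closed_field, field_char_0} poly3 \<Rightarrow> 'a poly fract poly fract poly fract" where
  "emb3 = lift_emb (lift_emb to_fract)"

definition partial :: "nat \<Rightarrow> 'a::idom poly3 \<Rightarrow> 'a poly3" where
  "partial i = (if i = 0 then dX else if i = 1 then dY else dZ)"

interpretation T: diff_field tower_const 3 tower_der
  unfolding numeral_3_eq_3 by (rule diff_field3)

interpretation E: fraction_embedding emb3
  unfolding emb3_def
  by (rule fraction_embedding_lift_emb[OF fraction_embedding_lift_emb[OF fraction_embedding_to_fract]])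

lemma tower_primitive:
  fixes \<eta> :: "nat \<Rightarrow> 'a::{alg_closed_field, field_char_0} poly fract poly fract poly fract"
  assumes "closed_form 3 tower_der \<eta>"
  shows "log_exact 3 tower_der tower_const \<eta>"
proof -
  \<comment> \<open>Without derivations a form has no components to match, so it is exact and the
    induction can start.\<close>
  have 0: "log_exact 0 (\<lambda>_ x. x) (\<lambda>x. x) \<theta>" for \<theta> :: "nat \<Rightarrow> 'a"
    by (rule log_exact.exact) simp
  have 1: "log_exact (Suc 0) der1 const1 \<theta>" if "closed_form (Suc 0) der1 \<theta>"
    for \<theta> :: "nat \<Rightarrow> 'a poly fract"
    using that unfolding der1_def const1_def
    by (rule diff_field.closed_imp_log_exact_extend[OF diff_field0, rotated]) (rule 0)
  have 2: "log_exact (Suc (Suc 0)) der2 const2 \<theta>" if "closed_form (Suc (Suc 0)) der2 \<theta>"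
    for \<theta> :: "nat \<Rightarrow> 'a poly fract poly fract"
    using that unfolding der2_def const2_def
    by (rule diff_field.closed_imp_log_exact_extend[OF diff_field1, rotated]) (rule 1)
  show ?thesis
    using assms unfolding numeral_3_eq_3 tower_der_def tower_const_def
    by (rule diff_field.closed_imp_log_exact_extend[OF diff_field2, rotated]) (rule 2)
qed

lemma derivation_partial: "derivation (partial i :: 'a::idom poly3 \<Rightarrow> _)"
proof -
  have "derivation (dX :: 'a poly3 \<Rightarrow> _)" "derivation (dY :: 'a poly3 \<Rightarrow> _)" "derivation (dZ :: 'a poly3 \<Rightarrow> _)"
    using derivation_map_poly[OF derivation_map_poly[OF derivation_pderiv]]
      derivation_map_poly[OF derivation_pderiv] derivation_pderiv
    by (simp_all add: dX_def[abs_def] dY_def[abs_def] dZ_def[abs_def])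
  then show ?thesis by (simp add: partial_def)
qed

lemma map_poly_lift:
  assumes "\<And>x. D (e x) = e (d x)" "e 0 = 0" "D 0 = 0" "d 0 = 0"
  shows "map_poly D (map_poly e p) = map_poly e (map_poly d p)"
  by (intro poly_eqI) (simp add: coeff_map_poly assms)

lemma pderiv_map_poly_hom:
  assumes "comm_ring_hom e"
  shows "pderiv (map_poly e p) = map_poly e (pderiv p)"
proof -
  interpret e: comm_ring_hom e by fact
  show ?thesis by (intro poly_eqI) (simp add: coeff_map_poly coeff_pderiv e.hom_mult e.hom_add e.hom_of_nat)
qed

lemma tower_der_emb3: 
  assumes "i < 3"
  shows "tower_der i (emb3 p) = emb3 (partial i p)"
proof -
  interpret e1: fraction_embedding "to_fract :: 'a poly \<Rightarrow> _" by (rule fraction_embedding_to_fract)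
  interpret e2: fraction_embedding "lift_emb (to_fract :: 'a poly \<Rightarrow> _)"
    by (rule fraction_embedding_lift_emb[OF fraction_embedding_to_fract])
  note D0 = diff_field.D'_to_fract[OF diff_field0, folded der1_def]
    and D1 = diff_field.D'_to_fract[OF diff_field1, folded der2_def]
    and D2 = diff_field.D'_to_fract[OF diff_field2, folded tower_der_def]
    and d0 = diff_field.der'[OF diff_field0, folded der1_def]
    and d1 = diff_field.der'[OF diff_field1, folded der2_def]
  have e1: "comm_ring_hom (to_fract :: 'a poly \<Rightarrow> _)" and e2: "comm_ring_hom (lift_emb (to_fract :: 'a poly \<Rightarrow> _))"
    by unfold_locales
  have 1: "der1 0 (to_fract x) = to_fract (pderiv x)" for x :: "'a poly"
    by (rule D0)
  have 2: "der2 0 (lift_emb to_fract x) = lift_emb to_fract (map_poly pderiv x)" for x :: "'a poly poly"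
    by (simp add: lift_emb_def D1 map_poly_lift[where e = to_fract and d = pderiv, OF 1] derivation_0[OF d0])
  have 3: "der2 (Suc 0) (lift_emb to_fract x) = lift_emb to_fract (pderiv x)" for x :: "'a poly poly"
    by (simp add: lift_emb_def D1 pderiv_map_poly_hom[OF e1])
  have "i = 0 \<or> i = Suc 0 \<or> i = Suc (Suc 0)" using assms by auto
  then show ?thesis
    by (elim disjE)
      (simp_all add: emb3_def lift_emb_def[of "lift_emb to_fract"] D2 partial_def
        dX_def dY_def dZ_def map_poly_lift[where e = "lift_emb to_fract" and d = "map_poly pderiv", OF 2] map_poly_lift[where e = "lift_emb to_fract" and d = pderiv, OF 3] derivation_0[OF d1]
        pderiv_map_poly_hom[OF e2])
qed

lemma lift_emb_const: "e 0 = 0 \<Longrightarrow> lift_emb e [:c:] = to_fract [:e c:]"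
  unfolding lift_emb_def
  by (rule arg_cong[of _ _ to_fract], rule poly_eqI) (simp add: coeff_map_poly coeff_pCons split: nat.split)

lemma tower_const_emb3: "tower_const c = emb3 [:[:[:c:]:]:]"
  by (simp add: tower_const_def const2_def const1_def emb3_def lift_emb_const lift_emb_def[of _ 0] const_fract_def
      diff_field.iota'_def[OF diff_field0] diff_field.iota'_def[OF diff_field1[unfolded const1_def]]
      diff_field.iota'_def[OF diff_field2[unfolded const2_def const1_def]])

text \<open>Differentiation lowers the degree in its variable, so a prime dividing all its partial
  derivatives would have degree 0 in Z, then in Y, then in X, and would be a constant. This supplies
  for every prime a direction, depending on it, in which pole orders rise.\<close>

lemma prime_not_dvd_partial:
  fixes p :: "'a::field_char_0 poly3"
  assumes p: "prime_elem p"
  shows "\<exists>i<3. \<not> p dvd partial i p"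
proof (rule ccontr)
  assume *: "\<not> (\<exists>i<3. \<not> p dvd partial i p)"
  have "p dvd partial i p" if "i < 3" for i using * that by blast
  from this[of 0] this[of 1] this[of 2] have d: "p dvd dX p" "p dvd dY p" "p dvd dZ p"
    by (simp_all add: partial_def)
  have "degree p = 0" using not_dvd_pderiv[of p] d(3) by (auto simp: dZ_def)
  then obtain q where q: "p = [:q:]" by (auto elim: degree_eq_zeroE)
  have "degree q = 0" using not_dvd_pderiv[of q] d(2) by (auto simp: q dY_def derivation_map_poly_pCons[OF derivation_pderiv])
  then obtain r where r: "q = [:r:]" by (auto elim: degree_eq_zeroE)
  have "degree r = 0" using not_dvd_pderiv[of r] d(1) by (auto simp: q r dX_def derivation_map_poly_pCons[OF derivation_pderiv]
        derivation_map_poly_pCons[OF derivation_map_poly[OF derivation_pderiv]])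
  then obtain c where c: "r = [:c:]" by (auto elim: degree_eq_zeroE)
  have "p \<noteq> 0" using prime_elem_not_zeroI[OF p] .
  then have "p dvd 1" by (simp add: q r c is_unit_const_poly_iff)
  then show False using prime_elem_not_unit[OF p] by simp
qed

section \<open>Logarithmic differentials of polynomials\<close>

definition dlog :: "nat \<Rightarrow> 'a::{alg_closed_field, field_char_0} poly3 \<Rightarrow> 'a poly fract poly fract poly fract" where
  "dlog i p = emb3 (partial i p) / emb3 p"

lemma dlog_eq: "i < 3 \<Longrightarrow> dlog i p = tower_der i (emb3 p) / emb3 p"
  by (simp add: dlog_def tower_der_emb3)

lemma dlog_mult:
  assumes "i < 3" "p \<noteq> 0" "q \<noteq> 0"
  shows "dlog i (p * q) = dlog i p + dlog i q"
  using derivation_dlog_mult[OF T.der[OF assms(1)], of "emb3 p" "emb3 q"] assms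
  by (simp add: dlog_eq E.hom_mult)

lemma poly3_unitE:
  fixes w :: "'a::field poly3"
  assumes "w dvd 1"
  obtains k where "w = [:[:[:k:]:]:]" "k \<noteq> 0"
  using assms by (auto simp: is_unit_poly_iff elim!: degree_eq_zeroE)

lemma poly3_const_unit: "k \<noteq> 0 \<Longrightarrow> [:[:[:k::'a::field:]:]:] dvd 1"
  by (simp add: is_unit_const_poly_iff)

lemma partial_const: "partial i [:[:[:k:]:]:] = 0"
  by (simp add: partial_def dX_def dY_def dZ_def derivation_map_poly_pCons[OF derivation_pderiv]
      derivation_map_poly_pCons[OF derivation_map_poly[OF derivation_pderiv]])

lemma dlog_unit: "w dvd 1 \<Longrightarrow> dlog i w = 0"
  by (auto elim!: poly3_unitE simp: dlog_def partial_const)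

definition nonassociated_primes :: "'a::field poly3 set \<Rightarrow> bool" where
  "nonassociated_primes Q \<longleftrightarrow> finite Q \<and> (\<forall>p\<in>Q. prime_elem p) \<and> (\<forall>p\<in>Q. \<forall>q\<in>Q. p \<noteq> q \<longrightarrow> \<not> p dvd q)"

lemma prime_elem_dvd_sym:
  fixes p q :: "'a::idom"
  assumes "prime_elem p" "prime_elem q" "p dvd q"
  shows "q dvd p"
proof -
  obtain w where w: "q = p * w" using assms(3) by (elim dvdE)
  have "w dvd 1"
    using irreducibleD[OF prime_elem_imp_irreducible[OF assms(2)] w] prime_elem_not_unit[OF assms(1)] by blast
  then obtain v where "1 = w * v" by (elim dvdE)
  then have "p = q * v" unfolding w by (simp add: mult.assoc)
  then show ?thesis by simp
qed

definition log_sum :: "'a::{alg_closed_field, field_char_0} poly3 set \<Rightarrow> ('a poly3 \<Rightarrow> 'a) \<Rightarrow> _ \<Rightarrow> nat \<Rightarrow> _" where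
  "log_sum Q lam a i = (\<Sum>p\<in>Q. tower_const (lam p) * dlog i p) + tower_der i a"

text \<open>A normal form with one residue per associate class of primes. Requiring \<open>Q\<close>
  to contain \<open>Q0\<close> lets the given factors be the representatives of their
  classes.\<close>

definition has_log_sum :: "'a::{alg_closed_field, field_char_0} poly3 set \<Rightarrow> (nat \<Rightarrow> _) \<Rightarrow> bool" where
  "has_log_sum Q0 \<eta> \<longleftrightarrow> (\<exists>Q lam a. Q0 \<subseteq> Q \<and> nonassociated_primes Q \<and> (\<forall>i<3. \<eta> i = log_sum Q lam a i))"

text \<open>Units have zero logarithmic differential. So if \<open>Q\<close> already has an
  associate of \<open>p\<close>, its coefficient grows by \<open>c\<close>; otherwise
  \<open>p\<close> joins \<open>Q\<close> with coefficient \<open>c\<close>.\<close>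

lemma has_log_sum_add_prime:
  assumes "has_log_sum Q0 \<eta>" and p: "prime_elem p"
    and \<theta>: "\<And>i. i < 3 \<Longrightarrow> \<theta> i = \<eta> i + tower_const c * dlog i p"
  shows "has_log_sum Q0 \<theta>"
proof -
  obtain Q lam a where Q0: "Q0 \<subseteq> Q" and Q: "nonassociated_primes Q"
    and \<eta>: "\<forall>i<3. \<eta> i = log_sum Q lam a i"
    using assms(1) unfolding has_log_sum_def by blast
  have fin: "finite Q" using Q by (simp add: nonassociated_primes_def)
  have upd: "(\<Sum>x\<in>Q. tower_const ((lam(q := lam q + c)) x) * dlog i x)
      = (\<Sum>x\<in>Q. tower_const (lam x) * dlog i x) + tower_const c * dlog i q" if "q \<in> Q" for q i
  proof -
    have "(\<Sum>x\<in>Q. tower_const ((lam(q := lam q + c)) x) * dlog i x)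
       = (\<Sum>x\<in>Q. tower_const (lam x) * dlog i x + (if x = q then tower_const c * dlog i q else 0))"
      by (intro sum.cong) (auto simp: T.hom_add distrib_right)
    then show ?thesis using fin that by (simp add: sum.distrib)
  qed
  show ?thesis
  proof (cases "\<exists>q\<in>Q. q dvd p")
    case True
    then obtain q where q: "q \<in> Q" "q dvd p" by blast
    then have qp: "prime_elem q" using Q by (simp add: nonassociated_primes_def)
    obtain w where w: "p = q * w" using q(2) by (elim dvdE)
    have wu: "w dvd 1"
      using irreducibleD[OF prime_elem_imp_irreducible[OF p] w] prime_elem_not_unit[OF qp] by blast
    have dl: "dlog i p = dlog i q" if "i < 3" for i
      using dlog_mult[OF that, of q w] w wu prime_elem_not_zeroI[OF p] by (auto simp: dlog_unit)
    have "\<forall>i<3. \<theta> i = log_sum Q (lam(q := lam q + c)) a i"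
      unfolding log_sum_def upd[OF q(1)] using \<eta> by (simp add: \<theta> dl log_sum_def)
    then show ?thesis using Q0 Q unfolding has_log_sum_def by blast
  next
    case False
    then have pQ: "p \<notin> Q" by auto
    have "\<not> p dvd q" if "q \<in> Q" for q
    proof
      assume pq: "p dvd q"
      have "prime_elem q" using Q that by (simp add: nonassociated_primes_def)
      from prime_elem_dvd_sym[OF p this pq] False that show False by simp
    qed
    then have Q': "nonassociated_primes (insert p Q)"
      using False Q p by (auto simp: nonassociated_primes_def)
    have "(\<Sum>x\<in>Q. tower_const ((lam(p := c)) x) * dlog i x) = (\<Sum>x\<in>Q. tower_const (lam x) * dlog i x)" for i
      using pQ by (intro sum.cong) auto
    then have "\<forall>i<3. \<theta> i = log_sum (insert p Q) (lam(p := c)) a i"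
      using \<eta> fin pQ by (simp add: \<theta> log_sum_def)
    then show ?thesis using Q0 Q' unfolding has_log_sum_def by blast
  qed
qed

lemma has_log_sum_add_dlog:
  assumes \<eta>: "has_log_sum Q0 \<eta>" and x: "x \<noteq> 0"
    and \<theta>: "\<And>i. i < 3 \<Longrightarrow> \<theta> i = \<eta> i + tower_const c * dlog i x"
  shows "has_log_sum Q0 \<theta>"
proof (cases "x dvd 1")
  case True
  with \<eta> show ?thesis by (simp add: has_log_sum_def \<theta> dlog_unit)
next
  case False
  have *: "has_log_sum Q0 \<theta>" if "\<forall>q\<in>#F. irreducible q"
    "\<And>i. i < 3 \<Longrightarrow> \<theta> i = \<eta> i + tower_const c * dlog i (prod_mset F)" for F \<theta>
    using that
  proof (induction F arbitrary: \<theta>)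
    case empty
    with \<eta> show ?case by (simp add: has_log_sum_def dlog_unit)
  next
    case (add q F)
    have q: "prime_elem q" using add.prems by simp
    have nz: "q \<noteq> 0" "prod_mset F \<noteq> 0" using add.prems by auto
    have "has_log_sum Q0 (\<lambda>i. \<eta> i + tower_const c * dlog i (prod_mset F))"
      using add.prems(1) by (intro add.IH) auto
    from has_log_sum_add_prime[OF this q, of _ c] add.prems(2) show ?case
      using nz by (simp add: dlog_mult algebra_simps)
  qed
  from mset_factors_exist[OF x False] obtain F where "mset_factors F x" ..
  then have "prod_mset F = x" "\<forall>q\<in>#F. irreducible q" by (auto dest: mset_factorsD)
  with *[of F \<theta>] \<theta> show ?thesis by simp
qed

lemma log_exact_imp_has_log_sum:
  assumes "log_exact 3 tower_der tower_const \<eta>" "nonassociated_primes Q0"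
  shows "has_log_sum Q0 \<eta>"
  using assms(1)
proof induction
  case (exact \<eta> a)
  then have "\<forall>i<3. \<eta> i = log_sum Q0 (\<lambda>_. 0) a i" by (simp add: log_sum_def)
  then show ?case using assms(2) unfolding has_log_sum_def by blast
next
  case (log \<eta> g \<theta> c)
  obtain x y where xy: "y \<noteq> 0" "g = emb3 x / emb3 y" using E.quot by blast
  have x: "x \<noteq> 0" using xy log.hyps by auto
  have dg: "tower_der i g / g = dlog i x - dlog i y" if "i < 3" for i
    using derivation_dlog_divide[OF T.der[OF that], of "emb3 x" "emb3 y"] x xy that by (simp add: dlog_eq)
  have "has_log_sum Q0 (\<lambda>i. \<eta> i + tower_const c * dlog i x)"
    by (rule has_log_sum_add_dlog[OF log.IH x, where c = c]) simp
  then show ?case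
    by (rule has_log_sum_add_dlog[OF _ xy(1), where c = "- c"])
      (simp add: log.hyps(3) dg T.hom_uminus right_diff_distrib del: times_divide_eq_right)
qed

subsection \<open>Poles of closed forms\<close>

lemma reg_const: "prime_elem p \<Longrightarrow> regular_at emb3 p (tower_const c)"
  unfolding tower_const_emb3 by (rule E.reg_emb)

lemma reg_dlog: "prime_elem p \<Longrightarrow> \<not> p dvd q \<Longrightarrow> regular_at emb3 p (dlog i q)"
  unfolding dlog_def by (rule E.reg_div_emb)

text \<open>Logarithmic terms have at most simple poles, which \<open>p ^ Suc m\<close> clears. The
  bound therefore passes to the derivative of \<open>a\<close>, and \<open>a\<close> itself has one
  order less.\<close>

lemma reg_exact_part:
  assumes p: "prime_elem p" and Q: "\<And>q. q \<in> Q \<Longrightarrow> q = p \<or> \<not> p dvd q"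
    and i: "i < 3" "\<not> p dvd partial i p"
    and reg: "regular_at emb3 p (emb3 p ^ Suc m * log_sum Q lam a i)"
  shows "regular_at emb3 p (emb3 p ^ m * a)"
proof (rule E.pole_order_derivation[OF p T.der[OF i(1)] tower_der_emb3[OF i(1)] i(2)])
  have p0: "emb3 p \<noteq> 0" using prime_elem_not_zeroI[OF p] by simp
  have "regular_at emb3 p (emb3 p ^ Suc m * (tower_const (lam q) * dlog i q))" if "q \<in> Q" for q
  proof (cases "q = p")
    case True
    have eq: "emb3 p ^ Suc m * (tower_const (lam q) * dlog i q) = tower_const (lam q) * emb3 (p ^ m * partial i p)"
      using p0 by (simp add: True dlog_def E.hom_mult E.hom_power)
    show ?thesis unfolding eq by (rule E.reg_mult[OF p reg_const[OF p] E.reg_emb[OF p]])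
  next
    case False
    then have "\<not> p dvd q" using Q that by blast
    from E.reg_mult[OF p E.reg_emb[OF p] E.reg_mult[OF p reg_const[OF p] reg_dlog[OF p this]], of "p ^ Suc m"]
    show ?thesis by (simp add: E.hom_power E.hom_mult)
  qed
  from E.reg_sum[OF p this]
  have "regular_at emb3 p (\<Sum>q\<in>Q. emb3 p ^ Suc m * (tower_const (lam q) * dlog i q))" .
  from E.reg_diff[OF p reg this]
  show "regular_at emb3 p (emb3 p ^ Suc m * tower_der i a)"
    by (simp add: log_sum_def distrib_left sum_distrib_left del: power_Suc)
qed

text \<open>Regularity of the sum makes \<open>a\<close> regular, hence its derivative too. The
  other primes contribute no pole along \<open>p\<close>, so the term of \<open>p\<close> is regular
  alone, although \<open>p\<close> does not divide its own derivative in direction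
  \<open>i\<close>.\<close>

lemma residue_eq_0:
  assumes p: "prime_elem p" and Q: "\<And>q. q \<in> Q \<Longrightarrow> q = p \<or> \<not> p dvd q" "finite Q" "p \<in> Q"
    and i: "i < 3" "\<not> p dvd partial i p"
    and reg: "regular_at emb3 p (log_sum Q lam a i)"
  shows "lam p = 0"
proof (rule ccontr)
  assume nz: "lam p \<noteq> 0"
  have "regular_at emb3 p (emb3 p ^ Suc 0 * log_sum Q lam a i)"
    using E.reg_mult[OF p E.reg_emb[OF p] reg] by simp
  from reg_exact_part[OF p Q(1) i this] have "regular_at emb3 p a" by simp
  then have a: "regular_at emb3 p (tower_der i a)"
    by (rule E.reg_derivation[OF p T.der[OF i(1)] tower_der_emb3[OF i(1)]])
  have "regular_at emb3 p (tower_const (lam q) * dlog i q)" if "q \<in> Q - {p}" for q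
    using that Q(1)[of q] by (intro E.reg_mult[OF p reg_const[OF p] reg_dlog[OF p]]) auto
  from E.reg_sum[OF p this] have s: "regular_at emb3 p (\<Sum>q\<in>Q - {p}. tower_const (lam q) * dlog i q)" .
  have "log_sum Q lam a i - tower_der i a - (\<Sum>q\<in>Q - {p}. tower_const (lam q) * dlog i q)
      = tower_const (lam p) * dlog i p"
    using Q(2,3) by (simp add: log_sum_def sum.remove[of Q p])
  also have "\<dots> = emb3 ([:[:[:lam p:]:]:] * partial i p) / emb3 p"
    unfolding dlog_def tower_const_emb3 E.hom_mult by simp
  finally have "regular_at emb3 p (emb3 ([:[:[:lam p:]:]:] * partial i p) / emb3 p)"
    using E.reg_diff[OF p E.reg_diff[OF p reg a] s] by simp
  then have "p dvd [:[:[:lam p:]:]:] * partial i p" by (rule E.dvd_of_reg[OF p])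
  moreover have "\<not> p dvd [:[:[:lam p:]:]:]"
    using poly3_const_unit[OF nz] prime_elem_not_unit[OF p] dvd_trans by blast
  ultimately show False using i(2) prime_elem_dvd_mult_iff[OF p] by blast
qed

lemma regular_at_dvd: "q dvd p \<Longrightarrow> regular_at e q x \<Longrightarrow> regular_at e p x"
  by (elim regular_atE, rule regular_atI) (auto intro: dvd_trans)

lemma dlog_power:
  assumes "i < 3" "p \<noteq> 0"
  shows "dlog i (p ^ k) = of_nat k * dlog i p"
  by (induction k) (simp_all add: dlog_unit dlog_mult assms algebra_simps)

lemma dlog_prod:
  assumes "i < 3" "finite A" "\<And>j. j \<in> A \<Longrightarrow> g j \<noteq> 0"
  shows "dlog i (\<Prod>j\<in>A. g j) = (\<Sum>j\<in>A. dlog i (g j))"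
  using assms(2,3) by (induction A rule: finite_induct) (simp_all add: dlog_unit dlog_mult assms(1))

text \<open>The prime \<open>p\<close> may be associated to a member of \<open>Q\<close> without
  being one; the claim is then proved for that member and carried back through the units
  \<open>w\<close> and \<open>v\<close>.\<close>

lemma regular_log_sum:
  assumes Q: "nonassociated_primes Q" and p: "prime_elem p"
    and reg: "\<And>i. i < 3 \<Longrightarrow> regular_at emb3 p (emb3 p ^ Suc m * log_sum Q lam a i)"
  shows "regular_at emb3 p (emb3 p ^ m * a)"
proof (cases "\<exists>q\<in>Q. p dvd q")
  case False
  from prime_not_dvd_partial[OF p] obtain i where i: "i < 3" "\<not> p dvd partial i p" by blast
  show ?thesis
    by (rule reg_exact_part[OF p _ i reg[OF i(1)]]) (use False in blast)
next
  case True
  then obtain q where q: "q \<in> Q" "p dvd q" by blast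
  have qp: "prime_elem q" using Q q by (simp add: nonassociated_primes_def)
  have qdp: "q dvd p" by (rule prime_elem_dvd_sym[OF p qp q(2)])
  obtain w where w: "q = p * w" using q(2) by (elim dvdE)
  obtain v where v: "p = q * v" using qdp by (elim dvdE)
  have reg': "regular_at emb3 q (emb3 q ^ Suc m * log_sum Q lam a i)" if "i < 3" for i
  proof -
    have eq: "emb3 q ^ Suc m * log_sum Q lam a i = emb3 (w ^ Suc m) * (emb3 p ^ Suc m * log_sum Q lam a i)"
      by (simp only: w E.hom_mult E.hom_power power_mult_distrib ac_simps)
    show ?thesis
      unfolding eq by (rule E.reg_mult[OF qp E.reg_emb[OF qp] regular_at_dvd[OF q(2) reg[OF that]]])
  qed
  from prime_not_dvd_partial[OF qp] obtain i where i: "i < 3" "\<not> q dvd partial i q" by blast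
  have "x = q \<or> \<not> q dvd x" if "x \<in> Q" for x
    using Q q(1) that by (auto simp: nonassociated_primes_def)
  from reg_exact_part[OF qp this i reg'[OF i(1)]] have "regular_at emb3 q (emb3 q ^ m * a)" .
  from E.reg_mult[OF p E.reg_emb[OF p] regular_at_dvd[OF qdp this]]
  have "regular_at emb3 p (emb3 (v ^ m) * (emb3 q ^ m * a))" .
  moreover have "emb3 (v ^ m) * (emb3 q ^ m * a) = emb3 p ^ m * a"
    by (subst v) (simp only: E.hom_mult E.hom_power power_mult_distrib ac_simps)
  ultimately show ?thesis by simp
qed

lemma prime_dvd_prod_power:
  assumes "prime_elem (p :: 'a::idom)" "finite A" "p dvd (\<Prod>i\<in>A. g i ^ e i)"
  shows "\<exists>i\<in>A. p dvd g i"
  using assms(2,3)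
proof (induction A rule: finite_induct)
  case empty
  then show ?case using prime_elem_not_unit[OF assms(1)] by simp
next
  case (insert i A)
  then have "p dvd g i ^ e i \<or> p dvd (\<Prod>i\<in>A. g i ^ e i)"
    using prime_elem_dvd_multD[OF assms(1)] by simp
  then show ?case using prime_elem_dvd_power[OF assms(1)] insert.IH by blast
qed

section \<open>Closed forms with denominator f\<close>

locale factored =
  fixes r :: nat and fs :: "nat \<Rightarrow> 'a::{alg_closed_field, field_char_0} poly3" and es :: "nat \<Rightarrow> nat"
  assumes prime_fs: "i < r \<Longrightarrow> prime_elem (fs i)"
    and nonassoc: "i < r \<Longrightarrow> j < r \<Longrightarrow> i \<noteq> j \<Longrightarrow> \<not> fs i dvd fs j"
    and es_pos: "i < r \<Longrightarrow> es i \<ge> 1"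
begin

definition "f = (\<Prod>i<r. fs i ^ es i)"
definition "q = (\<Prod>i<r. fs i ^ (es i - 1))"
definition "S = (\<Prod>i<r. fs i)"
definition "cof i = (\<Prod>j\<in>{..<r} - {i}. fs j)"

text \<open>The numerator over f of the form \<open>log_form\<close>. Here \<open>S\<close> is the
  radical of \<open>f = q * S\<close>, \<open>cof j\<close> is \<open>S / fs j\<close>, and the last
  sum is S dq/q, the logarithmic derivative of q cleared of denominators.\<close>

definition Phi :: "(nat \<Rightarrow> 'a) \<Rightarrow> 'a poly3 \<Rightarrow> nat \<Rightarrow> 'a poly3" where
  "Phi lam A i = q * (\<Sum>j<r. [:[:[:lam j:]:]:] * cof j * partial i (fs j))
     + (S * partial i A - A * (\<Sum>j<r. of_nat (es j - 1) * cof j * partial i (fs j)))"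

definition log_form where
  "log_form lam A i = (\<Sum>j<r. tower_const (lam j) * dlog i (fs j)) + tower_der i (emb3 A / emb3 q)"

lemma fs_nz: "i < r \<Longrightarrow> fs i \<noteq> 0"
  using prime_elem_not_zeroI[OF prime_fs] .

lemma nz: "f \<noteq> 0" "q \<noteq> 0" "S \<noteq> 0"
  using fs_nz by (auto simp: f_def q_def S_def)

lemma f_eq: "f = q * S"
  unfolding f_def q_def S_def prod.distrib[symmetric]
proof (rule prod.cong)
  fix i assume "i \<in> {..<r}"
  then have "es i = Suc (es i - 1)" using es_pos[of i] by simp
  then show "fs i ^ es i = fs i ^ (es i - 1) * fs i" by (metis power_Suc2)
qed simp

lemma S_eq: "i < r \<Longrightarrow> S = fs i * cof i"
  unfolding S_def cof_def by (simp add: prod.remove)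

lemma prime_dvd_f:
  assumes "prime_elem p" "p dvd f"
  obtains j where "j < r" "p dvd fs j"
proof -
  have "\<exists>j<r. p dvd fs j"
    using prime_dvd_prod_power[OF assms(1) _ assms(2)[unfolded f_def]] by auto
  then show thesis using that by blast
qed

lemma inj_fs: "inj_on fs {..<r}"
  using nonassoc by (intro inj_onI) (metis dvd_refl lessThan_iff)

lemma nonassociated_fs: "nonassociated_primes (fs ` {..<r})"
  unfolding nonassociated_primes_def using prime_fs nonassoc by (metis finite_imageI finite_lessThan imageE lessThan_iff)

text \<open>Along \<open>fs j\<close> the form has a pole of order at most \<open>es j\<close>, so
  its exact part \<open>a\<close> has order at most \<open>es j - 1\<close>, which is what
  \<open>q\<close> clears. At primes off f the form is regular, so the residue there
  vanishes.\<close>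

lemma pole_free:
  assumes Q: "nonassociated_primes Q" "fs ` {..<r} \<subseteq> Q"
    and eq: "\<And>i. i < 3 \<Longrightarrow> emb3 (G i) / emb3 f = log_sum Q lam a i"
  shows "\<exists>A. emb3 q * a = emb3 A" and "p \<in> Q \<Longrightarrow> p \<notin> fs ` {..<r} \<Longrightarrow> lam p = 0"
proof -
  show "\<exists>A. emb3 q * a = emb3 A"
  proof (rule E.emb_if_regular)
    fix p :: "'a poly3" assume p: "prime_elem p"
    show "regular_at emb3 p (emb3 q * a)"
    proof (cases "p dvd f")
      case False
      have "regular_at emb3 p (emb3 p ^ Suc 0 * log_sum Q lam a i)" if "i < 3" for i
        unfolding eq[OF that, symmetric] E.hom_power[symmetric]
        by (rule E.reg_mult[OF p E.reg_emb[OF p] E.reg_div_emb[OF p False]])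
      from regular_log_sum[OF Q(1) p this] have "regular_at emb3 p a" by simp
      then show ?thesis by (rule E.reg_mult[OF p E.reg_emb[OF p]])
    next
      case True
      then obtain j where j: "j < r" "p dvd fs j" by (rule prime_dvd_f[OF p])
      have jp: "fs j dvd p" by (rule prime_elem_dvd_sym[OF p prime_fs[OF j(1)] j(2)])
      \<comment> \<open>Here \<open>p\<close> is only an associate of \<open>fs j\<close>;
        \<open>w\<close> and \<open>v\<close> translate powers of one into powers of the
        other.\<close>
      obtain w where w: "p = fs j * w" using jp by (elim dvdE)
      obtain v where v: "fs j = p * v" using j(2) by (elim dvdE)
      define m where "m = es j - 1"
      define g where "g = (\<Prod>i\<in>{..<r} - {j}. fs i ^ es i)"
      define h where "h = (\<Prod>i\<in>{..<r} - {j}. fs i ^ (es i - 1))"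
      have es: "es j = Suc m" using es_pos[OF j(1)] by (simp add: m_def)
      have f: "f = fs j ^ Suc m * g" and q: "q = fs j ^ m * h"
        using j(1) prod.remove[of "{..<r}" j "\<lambda>i. fs i ^ es i"] prod.remove[of "{..<r}" j "\<lambda>i. fs i ^ (es i - 1)"]
        by (simp_all add: f_def q_def g_def h_def es del: power_Suc)
      have pg: "\<not> p dvd g"
      proof
        assume "p dvd g"
        then obtain i where i: "i < r" "i \<noteq> j" "p dvd fs i"
          using prime_dvd_prod_power[OF p, of "{..<r} - {j}" fs es] unfolding g_def by auto
        then have "fs j dvd fs i" using jp dvd_trans by blast
        then show False using nonassoc j i by blast
      qed
      have fj0: "emb3 (fs j) \<noteq> 0" using fs_nz[OF j(1)] by simp
      have "regular_at emb3 p (emb3 p ^ Suc m * log_sum Q lam a i)" if "i < 3" for i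
      proof -
        have "emb3 p ^ Suc m * (emb3 (G i) / emb3 f) = emb3 (w ^ Suc m) * (emb3 (G i) / emb3 g)"
          unfolding w f E.hom_mult E.hom_power power_mult_distrib using fj0 by (simp del: power_Suc)
        then show ?thesis
          unfolding eq[OF that] using E.reg_mult[OF p E.reg_emb[OF p] E.reg_div_emb[OF p pg]] by simp
      qed
      from regular_log_sum[OF Q(1) p this] have "regular_at emb3 p (emb3 p ^ m * a)" .
      from E.reg_mult[OF p E.reg_emb[OF p] this]
      have "regular_at emb3 p (emb3 (v ^ m * h) * (emb3 p ^ m * a))" .
      moreover have "emb3 (v ^ m * h) * (emb3 p ^ m * a) = emb3 q * a"
        unfolding q v E.hom_mult E.hom_power power_mult_distrib by (simp only: ac_simps)
      ultimately show ?thesis by simp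
    qed
  qed
next
  assume pQ: "p \<in> Q" "p \<notin> fs ` {..<r}"
  have p: "prime_elem p" using Q(1) pQ by (simp add: nonassociated_primes_def)
  have pf: "\<not> p dvd f"
  proof
    assume "p dvd f"
    then obtain j where j: "j < r" "p dvd fs j" by (rule prime_dvd_f[OF p])
    then have "fs j \<in> Q" "p \<noteq> fs j" using Q(2) pQ by auto
    then show False using Q(1) pQ(1) j(2) by (auto simp: nonassociated_primes_def)
  qed
  from prime_not_dvd_partial[OF p] obtain i where i: "i < 3" "\<not> p dvd partial i p" by blast
  show "lam p = 0"
  proof (rule residue_eq_0[OF p _ _ pQ(1) i])
    show "x = p \<or> \<not> p dvd x" if "x \<in> Q" for x
      using Q(1) pQ(1) that by (auto simp: nonassociated_primes_def)
    show "finite Q" using Q(1) by (simp add: nonassociated_primes_def)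
    show "regular_at emb3 p (log_sum Q lam a i)"
      unfolding eq[OF i(1), symmetric] by (rule E.reg_div_emb[OF p pf])
  qed
qed

lemma closed_imp_log_form:
  assumes "closed_form 3 tower_der (\<lambda>i. emb3 (G i) / emb3 f)"
  obtains lam A where "\<And>i. i < 3 \<Longrightarrow> emb3 (G i) / emb3 f = log_form lam A i"
proof -
  from log_exact_imp_has_log_sum[OF tower_primitive[OF assms] nonassociated_fs]
  obtain Q lam a where Q0: "fs ` {..<r} \<subseteq> Q" and Q: "nonassociated_primes Q"
    and eq0: "\<forall>i<3. emb3 (G i) / emb3 f = log_sum Q lam a i"
    unfolding has_log_sum_def by auto
  then have eq: "emb3 (G i) / emb3 f = log_sum Q lam a i" if "i < 3" for i using that by simp
  obtain A where A: "emb3 q * a = emb3 A" using pole_free(1)[OF Q Q0 eq] by blast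
  then have a: "a = emb3 A / emb3 q" using nz by (simp add: field_simps)
  have "(\<Sum>p\<in>Q. tower_const (lam p) * dlog i p) = (\<Sum>p\<in>fs ` {..<r}. tower_const (lam p) * dlog i p)" for i
  proof (rule sum.mono_neutral_right)
    show "finite Q" using Q by (simp add: nonassociated_primes_def)
    show "\<forall>p\<in>Q - fs ` {..<r}. tower_const (lam p) * dlog i p = 0"
      using pole_free(2)[OF Q Q0 eq] by simp
  qed fact
  then have "emb3 (G i) / emb3 f = log_form (lam \<circ> fs) A i" if "i < 3" for i
    unfolding eq[OF that] by (simp add: log_sum_def log_form_def a sum.reindex[OF inj_fs])
  then show thesis by (rule that)
qed

text \<open>The zero form is regular everywhere, so all residues vanish. What remains says that all
  derivations kill A/q, and the constants of the tower are K.\<close>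

lemma log_form_eq_0:
  assumes "\<And>i. i < 3 \<Longrightarrow> log_form lam A i = 0"
  shows "\<forall>j<r. lam j = 0" and "\<exists>k. A = [:[:[:k:]:]:] * q"
proof -
  define a where "a = emb3 A / emb3 q"
  \<comment> \<open>\<open>log_sum\<close> is indexed by primes, \<open>log_form\<close> by
    positions; \<open>mu\<close> carries the coefficients across the injection
    \<open>fs\<close>.\<close>
  define mu where "mu = lam \<circ> the_inv_into {..<r} fs"
  have mu: "mu (fs j) = lam j" if "j < r" for j
    using the_inv_into_f_f[OF inj_fs, of j] that by (simp add: mu_def)
  have ls: "log_sum (fs ` {..<r}) mu a i = 0" if "i < 3" for i
    using assms[OF that] by (simp add: log_sum_def log_form_def a_def sum.reindex[OF inj_fs] mu)
  have "\<exists>B. a = emb3 B"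
  proof (rule E.emb_if_regular)
    fix p :: "'a poly3" assume p: "prime_elem p"
    have "regular_at emb3 p (emb3 p ^ Suc 0 * log_sum (fs ` {..<r}) mu a i)" if "i < 3" for i
      using E.reg_emb[OF p, of 0] by (simp add: ls[OF that])
    from regular_log_sum[OF nonassociated_fs p this] show "regular_at emb3 p a" by simp
  qed
  show lam: "\<forall>j<r. lam j = 0"
  proof (intro allI impI)
    fix j assume j: "j < r"
    note p = prime_fs[OF j]
    from prime_not_dvd_partial[OF p] obtain i where i: "i < 3" "\<not> fs j dvd partial i (fs j)" by blast
    have "mu (fs j) = 0"
    proof (rule residue_eq_0[OF p _ _ _ i])
      show "x = fs j \<or> \<not> fs j dvd x" if "x \<in> fs ` {..<r}" for x
        using that nonassoc[OF j] by auto
      show "regular_at emb3 (fs j) (log_sum (fs ` {..<r}) mu a i)"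
        using E.reg_emb[OF p, of 0] by (simp add: ls[OF i(1)])
    qed (use j in auto)
    then show "lam j = 0" by (simp add: mu[OF j])
  qed
  have "\<forall>i<3. tower_der i a = 0"
    using assms lam by (simp add: log_form_def a_def)
  then obtain k where "a = tower_const k" using T.const[of a] by blast
  then have "emb3 A = emb3 [:[:[:k:]:]:] * emb3 q"
    using nz by (simp add: a_def tower_const_emb3 field_simps)
  then have "A = [:[:[:k:]:]:] * q" by (simp only: E.hom_mult[symmetric] E.eq_iff)
  then show "\<exists>k. A = [:[:[:k:]:]:] * q" ..
qed

lemma emb_Phi:
  assumes i: "i < 3"
  shows "emb3 (Phi lam A i) / emb3 f = log_form lam A i"
proof -
  note e = E.hom_mult E.hom_add E.hom_minus E.hom_sum E.hom_of_nat
  have e0: "emb3 q \<noteq> 0" "emb3 S \<noteq> 0" using nz by auto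
  have cof: "emb3 (cof j) * emb3 (partial i (fs j)) = emb3 S * dlog i (fs j)" if "j < r" for j
    using S_eq[OF that] fs_nz[OF that] by (simp add: dlog_def e)
  have 1: "emb3 (\<Sum>j<r. [:[:[:lam j:]:]:] * cof j * partial i (fs j))
      = emb3 S * (\<Sum>j<r. tower_const (lam j) * dlog i (fs j))"
    unfolding e sum_distrib_left
    by (intro sum.cong) (auto simp: mult.assoc cof tower_const_emb3 mult.left_commute)
  have 2: "emb3 (\<Sum>j<r. of_nat (es j - 1) * cof j * partial i (fs j))
      = emb3 S * (\<Sum>j<r. of_nat (es j - 1) * dlog i (fs j))"
    unfolding e sum_distrib_left
    by (intro sum.cong) (auto simp: mult.assoc cof mult.left_commute)
  have 3: "(\<Sum>j<r. of_nat (es j - 1) * dlog i (fs j)) = tower_der i (emb3 q) / emb3 q"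
    unfolding dlog_eq[OF i, symmetric] q_def
    by (subst dlog_prod[OF i]) (use fs_nz in \<open>auto simp: dlog_power[OF i]\<close>)
  have 4: "tower_der i (emb3 A / emb3 q) = (emb3 (partial i A) - emb3 A * (tower_der i (emb3 q) / emb3 q)) / emb3 q"
    unfolding derivation_divide[OF T.der[OF i] e0(1)] using e0 by (simp add: tower_der_emb3[OF i] field_simps)
  have arith: "c * (s * L) + (s * a - b * (s * t)) = c * s * (L + (a - b * t) / c)" if "c \<noteq> 0"
    for a b c s t L :: "'a poly fract poly fract poly fract"
    using that by (simp add: field_simps)
  have "emb3 (Phi lam A i) = emb3 q * emb3 S * ((\<Sum>j<r. tower_const (lam j) * dlog i (fs j))
      + (emb3 (partial i A) - emb3 A * (tower_der i (emb3 q) / emb3 q)) / emb3 q)"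
    unfolding Phi_def E.hom_add E.hom_mult E.hom_minus 1 2 3 by (rule arith[OF e0(1)])
  then show ?thesis
    unfolding log_form_def 4 f_eq E.hom_mult using e0 by simp
qed

lemma closed_log_form: "closed_form 3 tower_der (log_form lam A)"
proof -
  have d: "tower_der i (dlog j p) = tower_der j (dlog i p)" if "i < 3" "j < 3" "p \<noteq> 0" for i j and p :: "'a poly3"
    using that by (simp add: dlog_eq derivation_divide[OF T.der] T.comm[of i j "emb3 p"])
  show ?thesis
    unfolding closed_form_def log_form_def
    using fs_nz by (auto simp: derivation_add[OF T.der] derivation_sum[OF T.der] derivation_mult[OF T.der]
        T.D_iota T.comm d intro!: sum.cong)
qed

end

section \<open>Homogeneity and the Euler operator\<close>

lemma mcoeff_eqI: "(\<And>i j k. mcoeff p i j k = mcoeff q i j k) \<Longrightarrow> p = q"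
  unfolding mcoeff_def by (intro poly_eqI)

lemma mcoeff_0: "mcoeff 0 i j k = 0"
  and mcoeff_add: "mcoeff (p + q) i j k = mcoeff p i j k + mcoeff q i j k"
  and mcoeff_diff: "mcoeff (p - q) i j k = mcoeff p i j k - mcoeff q i j k"
  for p q :: "'a::ab_group_add poly3"
  by (simp_all add: mcoeff_def)

lemma mcoeff_const_mult: "mcoeff ([:[:[:c:]:]:] * p) i j k = c * mcoeff p i j k"
  by (simp add: mcoeff_def)

lemma mcoeff_sc3: "mcoeff (sc3 c p) i j k = c * mcoeff p i j k"
  unfolding sc3_def by (rule mcoeff_const_mult)

lemma mcoeff_var_mult:
  "mcoeff (varX * p) i j k = (case i of 0 \<Rightarrow> 0 | Suc i \<Rightarrow> mcoeff p i j k)"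
  "mcoeff (varY * p) i j k = (case j of 0 \<Rightarrow> 0 | Suc j \<Rightarrow> mcoeff p i j k)"
  "mcoeff (varZ * p) i j k = (case k of 0 \<Rightarrow> 0 | Suc k \<Rightarrow> mcoeff p i j k)"
  by (auto simp: mcoeff_def varX_def varY_def varZ_def coeff_pCons split: nat.split)

lemma mcoeff_partial:
  "mcoeff (dX p) i j k = of_nat (Suc i) * mcoeff p (Suc i) j k"
  "mcoeff (dY p) i j k = of_nat (Suc j) * mcoeff p i (Suc j) k"
  "mcoeff (dZ p) i j k = of_nat (Suc k) * mcoeff p i j (Suc k)"
  by (simp_all add: mcoeff_def dX_def dY_def dZ_def coeff_map_poly coeff_pderiv of_nat_poly
      del: of_nat_Suc)

definition euler :: "'a::idom poly3 \<Rightarrow> 'a poly3" where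
  "euler p = varX * dX p + varY * dY p + varZ * dZ p"

lemma mcoeff_euler: "mcoeff (euler p) i j k = of_nat (i + j + k) * mcoeff p i j k"
  by (cases i; cases j; cases k)
    (simp_all add: euler_def mcoeff_add mcoeff_var_mult mcoeff_partial algebra_simps)

text \<open>Homogeneity as an eigenvalue equation of the Euler operator. The degree becomes a
  scalar, so differences such as d - s - 1 are not truncated, and rules for products and sums follow
  from the derivation property.\<close>

definition weight :: "'a::idom \<Rightarrow> 'a poly3 \<Rightarrow> bool" where
  "weight c p \<longleftrightarrow> euler p = [:[:[:c:]:]:] * p"

lemma weight_iff_mcoeff: "weight c p \<longleftrightarrow> (\<forall>i j k. mcoeff p i j k \<noteq> 0 \<longrightarrow> of_nat (i + j + k) = c)"
proof -
  have "weight c p \<longleftrightarrow> (\<forall>i j k. mcoeff (euler p) i j k = mcoeff ([:[:[:c:]:]:] * p) i j k)"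
    unfolding weight_def using mcoeff_eqI by metis
  then show ?thesis unfolding mcoeff_euler mcoeff_const_mult mult_cancel_right by blast
qed

lemma homogeneous_iff_weight:
  "homogeneous p n \<longleftrightarrow> weight (of_nat n) p" for p :: "'a::{idom, ring_char_0} poly3"
  unfolding homogeneous_def weight_iff_mcoeff by (simp only: of_nat_eq_iff)

lemma partial_simps: "partial 0 = dX" "partial 1 = dY" "partial 2 = dZ"
  by (simp_all add: partial_def fun_eq_iff)

lemma derivation_euler: "derivation (euler :: 'a::idom poly3 \<Rightarrow> _)"
proof -
  have "derivation (dX :: 'a poly3 \<Rightarrow> _)" "derivation (dY :: 'a poly3 \<Rightarrow> _)" "derivation (dZ :: 'a poly3 \<Rightarrow> _)"
    using derivation_partial[of 0] derivation_partial[of 1] derivation_partial[of 2]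
    by (simp_all add: partial_def[abs_def])
  then show ?thesis
    unfolding derivation_def[of euler] euler_def by (simp add: derivation_add derivation_mult algebra_simps)
qed

lemma const3_simps:
  "[:[:[:a + b:]:]:] = [:[:[:a:]:]:] + [:[:[:b:]:]:]"
  "[:[:[:a * b:]:]:] = [:[:[:a:]:]:] * [:[:[:b:]:]:]"
  for a b :: "'a::comm_ring_1"
  by (simp_all add: mult.commute)

lemma const3_of_nat: "[:[:[:of_nat n:]:]:] = of_nat n"
  by (simp add: of_nat_poly)

lemma const3_sum: "[:[:[:\<Sum>x\<in>A. g x:]:]:] = (\<Sum>x\<in>A. [:[:[:g x:]:]:])"
  for g :: "'b \<Rightarrow> 'a::comm_ring_1"
  by (induction A rule: infinite_finite_induct) (simp_all add: const3_simps(1))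

lemma weight_mult:
  assumes "weight a p" "weight b q"
  shows "weight (a + b) (p * q)"
  using assms unfolding weight_def const3_simps derivation_mult[OF derivation_euler]
  by (simp only: algebra_simps)

lemma weight_const: "weight 0 [:[:[:c:]:]:]"
  by (auto simp: weight_iff_mcoeff mcoeff_def coeff_pCons split: nat.splits)

lemma weight_1: "weight 0 1"
  using weight_const[of 1] by simp

lemma weight_const_mult: "weight a p \<Longrightarrow> weight a ([:[:[:c:]:]:] * p)"
  using weight_mult[OF weight_const, of a p c] by simp

lemma weight_add: "weight a p \<Longrightarrow> weight a q \<Longrightarrow> weight a (p + q)"
  unfolding weight_def derivation_add[OF derivation_euler] by (simp only: algebra_simps)

lemma weight_diff: "weight a p \<Longrightarrow> weight a q \<Longrightarrow> weight a (p - q)"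
  unfolding weight_def derivation_diff[OF derivation_euler] by (simp only: algebra_simps)

lemma weight_0: "weight a 0"
  by (simp add: weight_iff_mcoeff mcoeff_0)

lemma weight_sum: "(\<And>x. x \<in> A \<Longrightarrow> weight a (g x)) \<Longrightarrow> weight a (\<Sum>x\<in>A. g x)"
  by (induction A rule: infinite_finite_induct) (auto simp: weight_0 intro: weight_add)

lemma weight_power: "weight a p \<Longrightarrow> weight (of_nat n * a) (p ^ n)"
proof (induction n)
  case 0
  show ?case by (simp add: weight_1)
next
  case (Suc n)
  then show ?case using weight_mult[of a p "of_nat n * a" "p ^ n"] by (simp add: algebra_simps)
qed

lemma weight_prod:
  "(\<And>x. x \<in> A \<Longrightarrow> weight (w x) (g x)) \<Longrightarrow> finite A \<Longrightarrow> weight (\<Sum>x\<in>A. w x) (\<Prod>x\<in>A. g x)"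
proof (induction A rule: infinite_finite_induct)
  case empty
  show ?case by (simp add: weight_1)
qed (auto intro: weight_mult)

text \<open>For a constant \<open>p\<close> the weight -1 belongs to the zero polynomial, which has
  every weight.\<close>

lemma weight_partial: "weight a p \<Longrightarrow> weight (a - 1) (partial i p)"
proof -
  assume w: "weight a p"
  have *: "of_nat (i + j + k) = a" if "mcoeff p i j k \<noteq> 0" for i j k
    using w that unfolding weight_iff_mcoeff by blast
  have "weight (a - 1) (dX p)" "weight (a - 1) (dY p)" "weight (a - 1) (dZ p)"
    unfolding weight_iff_mcoeff mcoeff_partial mult_eq_0_iff
    using *[of "Suc _"] *[of _ "Suc _"] *[of _ _ "Suc _"] by (auto simp: algebra_simps)
  then show ?thesis by (simp add: partial_def)
qed

lemma weight_unique:
  assumes "weight a p" "weight b p" "p \<noteq> 0"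
  shows "a = b"
proof -
  have "\<exists>i j k. mcoeff p i j k \<noteq> 0"
    using assms(3) mcoeff_eqI[of p 0] by (auto simp: mcoeff_0)
  then show ?thesis using assms unfolding weight_iff_mcoeff by blast
qed

lemma varZ_dvd_iff: "varZ dvd p \<longleftrightarrow> coeff p 0 = 0"
proof
  assume "varZ dvd p"
  then show "coeff p 0 = 0" by (auto simp: varZ_def elim!: dvdE)
next
  assume "coeff p 0 = 0"
  moreover obtain c p' where "p = pCons c p'" by (cases p)
  ultimately have "p = varZ * p'" by (simp add: varZ_def)
  then show "varZ dvd p" by simp
qed

lemma varZ_nz: "varZ \<noteq> (0 :: 'a::comm_ring_1 poly3)"
  by (simp add: varZ_def)

lemma varZ_dvd_varY_mult: "varZ dvd varY * p \<Longrightarrow> varZ dvd (p :: 'a::idom poly3)"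
  by (simp add: varZ_dvd_iff varY_def)

lemma partial_var_mult:
  fixes p :: "'a::idom poly3"
  shows "dX (varX * p) = p + varX * dX p" "dX (varY * p) = varY * dX p" "dX (varZ * p) = varZ * dX p"
    "dY (varX * p) = varX * dY p" "dY (varY * p) = p + varY * dY p" "dY (varZ * p) = varZ * dY p"
  by (rule mcoeff_eqI; simp add: mcoeff_partial mcoeff_var_mult mcoeff_add algebra_simps split: nat.split)+

section \<open>The kernel as a space of closed forms\<close>

definition curl :: "'a::idom poly3 \<Rightarrow> 'a poly3 \<Rightarrow> 'a poly3 \<Rightarrow> 'a poly3" where
  "curl f G H = f * dY G - G * dY f - f * dX H + H * dX f"

text \<open>With \<open>K = - (X G + Y H) / Z\<close>, the form \<open>(G dX + H dY + K dZ) / f\<close> is annihilated by the Euler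
  field, so the three components of its differential are proportional to \<open>X\<close>, \<open>Y\<close>, \<open>Z\<close>.\<close>

lemma curl_relations:
  fixes f G H K :: "'a::idom poly3"
  assumes f: "weight c f" and G: "weight (c - 1) G" and H: "weight (c - 1) H"
    and K: "varX * G + varY * H + varZ * K = 0"
  shows "varZ * (f * (dZ G - dX K) - G * dZ f + K * dX f) = - varY * curl f G H"
    and "varZ * (f * (dZ H - dY K) - H * dZ f + K * dY f) = varX * curl f G H"
proof -
  define C where "C = [:[:[:c:]:]:]"
  have C1: "[:[:[:c - 1:]:]:] = C - 1" 
    using const3_simps(1)[of "c - 1" 1] by (simp add: C_def)
  have dadd: "dX (p + q) = dX p + dX q" "dY (p + q) = dY p + dY q" for p q :: "'a poly3"
    by (rule mcoeff_eqI; simp add: mcoeff_partial mcoeff_add algebra_simps)+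
  have d0: "dX 0 = (0 :: 'a poly3)" "dY 0 = (0 :: 'a poly3)" by (simp_all add: dX_def dY_def)
  \<comment> \<open>\<open>K\<close> is accessible only through Z K. So everything is multiplied by
    Z, after which \<open>K\<close>, its derivatives and the Z-derivatives are eliminated by the
    relation, its X- and Y-derivatives, and Euler's identity.\<close>
  have ZK: "varZ * K = - (varX * G + varY * H)" using K by (simp add: add_eq_0_iff2)
  have "dX (varX * G + varY * H + varZ * K) = 0" "dY (varX * G + varY * H + varZ * K) = 0"
    unfolding K by (rule d0)+
  then have ZKX: "varZ * dX K = - (G + varX * dX G + varY * dX H)"
    and ZKY: "varZ * dY K = - (varX * dY G + (H + varY * dY H))"
    unfolding dadd partial_var_mult by (simp_all only: add_eq_0_iff)
  have Zf: "varZ * dZ f = C * f - varX * dX f - varY * dY f"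
    using f unfolding weight_def euler_def C_def[symmetric] by (simp add: algebra_simps)
  have ZG: "varZ * dZ G = (C - 1) * G - varX * dX G - varY * dY G"
    using G unfolding weight_def euler_def C1 by (simp add: algebra_simps)
  have ZH: "varZ * dZ H = (C - 1) * H - varX * dX H - varY * dY H"
    using H unfolding weight_def euler_def C1 by (simp add: algebra_simps)
  have "varZ * (f * (dZ G - dX K) - G * dZ f + K * dX f)
     = f * (varZ * dZ G - varZ * dX K) - G * (varZ * dZ f) + varZ * K * dX f"
    by (simp add: algebra_simps)
  also have "\<dots> = - varY * curl f G H"
    unfolding ZG ZKX Zf ZK curl_def by (simp add: algebra_simps)
  finally show "varZ * (f * (dZ G - dX K) - G * dZ f + K * dX f) = - varY * curl f G H" .
  have "varZ * (f * (dZ H - dY K) - H * dZ f + K * dY f)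
     = f * (varZ * dZ H - varZ * dY K) - H * (varZ * dZ f) + varZ * K * dY f"
    by (simp add: algebra_simps)
  also have "\<dots> = varX * curl f G H"
    unfolding ZH ZKY Zf ZK curl_def by (simp add: algebra_simps)
  finally show "varZ * (f * (dZ H - dY K) - H * dZ f + K * dY f) = varX * curl f G H" .
qed

text \<open>By \<open>curl_relations\<close>, Z divides Y times \<open>curl f G H\<close> and hence
  the curl itself, so the description in \<open>Rmap\<close> denotes the exact quotient. It vanishes
  together with the curl.\<close>

lemma Rker_iff:
  fixes f :: "'a::{idom, ring_char_0} poly3"
  assumes f: "homogeneous f d" and d: "d \<ge> 1"
  shows "(G, H) \<in> Rker d f \<longleftrightarrow> homogeneous G (d - 1) \<and> homogeneous H (d - 1)
    \<and> (\<exists>K. varX * G + varY * H + varZ * K = 0) \<and> curl f G H = 0"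
proof (cases "homogeneous G (d - 1) \<and> homogeneous H (d - 1) \<and> (\<exists>K. varX * G + varY * H + varZ * K = 0)")
  case True
  then obtain K where K: "varX * G + varY * H + varZ * K = 0" by blast
  have w: "weight (of_nat d) f" "weight (of_nat d - 1) G" "weight (of_nat d - 1) H"
    using f True d by (simp_all add: homogeneous_iff_weight of_nat_diff)
  have "varY * curl f G H = varZ * (- (f * (dZ G - dX K) - G * dZ f + K * dX f))"
    using curl_relations(1)[OF w K] by (metis minus_minus mult_minus_left mult_minus_right)
  then have "varZ dvd varY * curl f G H" by simp
  then have "varZ dvd curl f G H" by (rule varZ_dvd_varY_mult)
  then obtain Q where Q: "curl f G H = varZ * Q" by (elim dvdE)
  have "Rmap f (G, H) = Q"
    unfolding Rmap_def using Q varZ_nz by (auto simp: curl_def intro!: the_equality)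
  then have "Rmap f (G, H) = 0 \<longleftrightarrow> curl f G H = 0" using Q varZ_nz by auto
  moreover have "varX * G + varY * H = varZ * (- K)" using K by (simp add: add_eq_0_iff2)
  then have "varZ dvd varX * G + varY * H" by simp
  ultimately show ?thesis using True by (auto simp: Rker_def Espace_def hom_polys_def)
next
  case False
  have "\<exists>K. varX * G + varY * H + varZ * K = 0" if "varZ dvd varX * G + varY * H"
  proof -
    from that obtain L where "varX * G + varY * H = varZ * L" by (elim dvdE)
    then have "varX * G + varY * H + varZ * (- L) = 0" by simp
    then show ?thesis ..
  qed
  then show ?thesis using False by (auto simp: Rker_def Espace_def hom_polys_def)
qed

section \<open>Homogeneous f: describing the kernel by residues and a polynomial A\<close>

locale homogeneous_factored = factored r fs es
  for r and fs :: "nat \<Rightarrow> 'a::{alg_closed_field, field_char_0} poly3" and es +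
  fixes ds :: "nat \<Rightarrow> nat" and d :: nat
  assumes hom_fs: "i < r \<Longrightarrow> homogeneous (fs i) (ds i)"
    and hom_f: "homogeneous f d"
    and d_pos: "d \<ge> 1"
begin

definition "s = (\<Sum>i<r. ds i * (es i - 1))"

lemma weight_fs: "i < r \<Longrightarrow> weight (of_nat (ds i)) (fs i)"
  using hom_fs homogeneous_iff_weight by blast

lemma weight_q: "weight (of_nat s) q"
proof -
  have "weight (\<Sum>i<r. of_nat (es i - 1) * of_nat (ds i)) q"
    unfolding q_def by (intro weight_prod weight_power) (auto intro: weight_fs)
  then show ?thesis by (simp add: s_def mult.commute)
qed

lemma weight_f: "weight (of_nat d) f"
  using hom_f homogeneous_iff_weight by blast

text \<open>The identity between d and the degrees of the factors is not assumed; it comes from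
  comparing the two weights of the nonzero polynomial \<open>f = q * S\<close>.\<close>

lemma weight_S: "weight (of_nat d - of_nat s) S"
proof -
  have S: "weight (\<Sum>i<r. of_nat (ds i)) S"
    unfolding S_def by (intro weight_prod) (auto intro: weight_fs)
  from weight_unique[OF weight_f weight_mult[OF weight_q S, folded f_eq] nz(1)] S
  show ?thesis by simp
qed

lemma weight_cof_partial:
  assumes "j < r"
  shows "weight (of_nat d - of_nat s - 1) (cof j * partial i (fs j))"
proof -
  have "weight (\<Sum>x\<in>{..<r} - {j}. of_nat (ds x)) (cof j)"
    unfolding cof_def by (intro weight_prod) (auto intro: weight_fs)
  moreover from weight_unique[OF weight_S weight_mult[OF weight_fs[OF assms] this, folded S_eq[OF assms]] nz(3)]
  have "(\<Sum>x\<in>{..<r} - {j}. of_nat (ds x)) = of_nat d - of_nat s - (of_nat (ds j) :: 'a)"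
    by (simp add: algebra_simps)
  ultimately have "weight (of_nat d - of_nat s - of_nat (ds j)) (cof j)" by simp
  from weight_mult[OF this weight_partial[OF weight_fs[OF assms], of i]]
  have "weight (of_nat d - of_nat s - of_nat (ds j) + (of_nat (ds j) - 1)) (cof j * partial i (fs j))" .
  moreover have "of_nat d - of_nat s - of_nat (ds j) + (of_nat (ds j) - 1) = (of_nat d - of_nat s - 1 :: 'a)"
    by simp
  ultimately show ?thesis by (simp only:)
qed

lemma weight_Phi:
  assumes "weight (of_nat s) A"
  shows "weight (of_nat d - 1) (Phi lam A i)"
proof -
  have 1: "weight (of_nat d - of_nat s - 1) (\<Sum>j<r. [:[:[:c j:]:]:] * cof j * partial i (fs j))" for c
    unfolding mult.assoc by (intro weight_sum weight_const_mult weight_cof_partial) simp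
  note 2 = weight_mult[OF weight_q 1[of lam]]
  note 3 = weight_mult[OF assms 1[of "\<lambda>j. of_nat (es j - 1)", unfolded const3_of_nat]]
  note 4 = weight_mult[OF weight_S weight_partial[OF assms, of i]]
  show ?thesis
    unfolding Phi_def using 2 3 4 by (intro weight_add weight_diff) (simp_all add: algebra_simps)
qed

text \<open>Contraction with the Euler field, multiplied by \<open>f = q * S\<close>: dlog of
  \<open>fs j\<close> contracts to \<open>ds j\<close>, and d(A/q) to
  \<open>(euler A - s * A) / q\<close>.\<close>

lemma euler_Phi:
  "varX * Phi lam A 0 + varY * Phi lam A 1 + varZ * Phi lam A 2
   = S * (q * [:[:[:\<Sum>j<r. lam j * of_nat (ds j):]:]:] + (euler A - of_nat s * A))"
proof -
  have cof: "cof j * euler (fs j) = of_nat (ds j) * S" if "j < r" for j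
    using weight_fs[OF that] S_eq[OF that] unfolding weight_def const3_of_nat by (simp add: ac_simps)
  have sum: "varX * (\<Sum>j<r. c j * cof j * dX (fs j)) + varY * (\<Sum>j<r. c j * cof j * dY (fs j))
      + varZ * (\<Sum>j<r. c j * cof j * dZ (fs j)) = (\<Sum>j<r. c j * of_nat (ds j)) * S" for c
  proof -
    have "varX * (\<Sum>j<r. c j * cof j * dX (fs j)) + varY * (\<Sum>j<r. c j * cof j * dY (fs j))
      + varZ * (\<Sum>j<r. c j * cof j * dZ (fs j)) = (\<Sum>j<r. c j * (cof j * euler (fs j)))"
      unfolding sum_distrib_left sum.distrib[symmetric] euler_def
      by (intro sum.cong) (simp_all only: algebra_simps)
    also have "\<dots> = (\<Sum>j<r. c j * of_nat (ds j)) * S"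
      unfolding sum_distrib_right by (intro sum.cong) (simp_all add: cof mult.assoc)
    finally show ?thesis .
  qed
  have s: "of_nat s = (\<Sum>j<r. of_nat (es j - 1) * of_nat (ds j) :: 'a poly3)"
    by (simp add: s_def mult.commute)
  have k: "[:[:[:\<Sum>j<r. lam j * of_nat (ds j):]:]:] = (\<Sum>j<r. [:[:[:lam j:]:]:] * of_nat (ds j))"
    unfolding const3_sum const3_simps(2) const3_of_nat ..
  have arith: "x * (q * l0 + (S * a0 - A * m0)) + y * (q * l1 + (S * a1 - A * m1)) + z * (q * l2 + (S * a2 - A * m2))
      = q * (x * l0 + y * l1 + z * l2) + S * (x * a0 + y * a1 + z * a2) - A * (x * m0 + y * m1 + z * m2)"
    for x y z l0 l1 l2 a0 a1 a2 m0 m1 m2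
    by (simp only: algebra_simps)
  have "varX * Phi lam A 0 + varY * Phi lam A 1 + varZ * Phi lam A 2
    = q * (varX * (\<Sum>j<r. [:[:[:lam j:]:]:] * cof j * dX (fs j)) + varY * (\<Sum>j<r. [:[:[:lam j:]:]:] * cof j * dY (fs j))
      + varZ * (\<Sum>j<r. [:[:[:lam j:]:]:] * cof j * dZ (fs j)))
     + S * euler A
     - A * (varX * (\<Sum>j<r. of_nat (es j - 1) * cof j * dX (fs j)) + varY * (\<Sum>j<r. of_nat (es j - 1) * cof j * dY (fs j))
      + varZ * (\<Sum>j<r. of_nat (es j - 1) * cof j * dZ (fs j)))"
    unfolding Phi_def partial_simps euler_def by (rule arith)
  also have "\<dots> = S * (q * [:[:[:\<Sum>j<r. lam j * of_nat (ds j):]:]:] + (euler A - of_nat s * A))"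
    unfolding sum s k by (simp only: algebra_simps)
  finally show ?thesis .
qed

lemma emb_quotient_symmetric_iff:
  assumes "i < 3" "j < 3"
  shows "tower_der i (emb3 x / emb3 f) = tower_der j (emb3 y / emb3 f)
    \<longleftrightarrow> partial i x * f - x * partial i f = partial j y * f - y * partial j f"
proof -
  have f0: "emb3 f \<noteq> 0" using nz by simp
  have "tower_der i (emb3 x / emb3 f) = emb3 (partial i x * f - x * partial i f) / (emb3 f * emb3 f)"
    if "i < 3" for i x
    unfolding derivation_divide[OF T.der[OF that] f0] tower_der_emb3[OF that] E.hom_minus E.hom_mult ..
  from this[OF assms(1)] this[OF assms(2)] show ?thesis using f0 by simp
qed

lemma Rker_Phi:
  assumes A: "homogeneous A s" and lam: "(\<Sum>j<r. lam j * of_nat (ds j)) = 0"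
  shows "(Phi lam A 0, Phi lam A 1) \<in> Rker d f"
proof -
  have w: "weight (of_nat s) A" using A homogeneous_iff_weight by blast
  have "weight (of_nat (d - 1)) (Phi lam A i)" for i
    using weight_Phi[OF w] d_pos by (simp add: of_nat_diff)
  then have hom: "homogeneous (Phi lam A i) (d - 1)" for i
    by (simp add: homogeneous_iff_weight)
  have eu: "euler A = of_nat s * A" using w unfolding weight_def const3_of_nat .
  \<comment> \<open>The third component of the form plays the part of \<open>K\<close>.\<close>
  have K: "varX * Phi lam A 0 + varY * Phi lam A 1 + varZ * Phi lam A 2 = 0"
    unfolding euler_Phi lam eu by simp
  have "tower_der 1 (log_form lam A 0) = tower_der 0 (log_form lam A 1)"
    using closed_log_form[of lam A] by (simp add: closed_form_def)
  then have "partial 1 (Phi lam A 0) * f - Phi lam A 0 * partial 1 f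
      = partial 0 (Phi lam A 1) * f - Phi lam A 1 * partial 0 f"
    by (subst emb_quotient_symmetric_iff[symmetric]) (simp_all add: emb_Phi)
  then have "curl f (Phi lam A 0) (Phi lam A 1) = 0"
    by (simp add: curl_def partial_def algebra_simps)
  then show ?thesis unfolding Rker_iff[OF hom_f d_pos] using hom K by blast
qed

lemma Rker_imp_Phi:
  assumes "(G, H) \<in> Rker d f"
  shows "\<exists>lam A. homogeneous A s \<and> (\<Sum>j<r. lam j * of_nat (ds j)) = 0 \<and> G = Phi lam A 0 \<and> H = Phi lam A 1"
proof -
  from assms obtain K where hom: "homogeneous G (d - 1)" "homogeneous H (d - 1)"
    and K: "varX * G + varY * H + varZ * K = 0" and curl: "curl f G H = 0"
    unfolding Rker_iff[OF hom_f d_pos] by blast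
  have w: "weight (of_nat d - 1) G" "weight (of_nat d - 1) H"
    using hom d_pos by (simp_all add: homogeneous_iff_weight of_nat_diff)
  \<comment> \<open>The three components of the form. Vanishing of the curl and the two
    \<open>curl_relations\<close>, with Z cancelled, are its three closedness equations cleared of
    denominators.\<close>
  define V where "V i = (if i = 0 then G else if i = 1 then H else K)" for i :: nat
  have rel: "f * dY G - G * dY f = f * dX H - H * dX f" using curl by (simp add: curl_def algebra_simps)
  have rel1: "f * (dZ G - dX K) - G * dZ f + K * dX f = 0"
    using curl_relations(1)[OF weight_f w K] by (simp add: curl varZ_nz)
  have rel2: "f * (dZ H - dY K) - H * dZ f + K * dY f = 0"
    using curl_relations(2)[OF weight_f w K] by (simp add: curl varZ_nz)
  have sym: "partial i (V j) * f - V j * partial i f = partial j (V i) * f - V i * partial j f"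
    if "i < 3" "j < 3" for i j
  proof -
    have "i = 0 \<or> i = 1 \<or> i = 2" "j = 0 \<or> j = 1 \<or> j = 2" using that by auto
    then show ?thesis using rel rel1 rel2
      by (elim disjE) (simp_all add: V_def partial_def algebra_simps)
  qed
  have "closed_form 3 tower_der (\<lambda>i. emb3 (V i) / emb3 f)"
    unfolding closed_form_def using emb_quotient_symmetric_iff sym by simp
  then obtain lam A where eq: "\<And>i. i < 3 \<Longrightarrow> emb3 (V i) / emb3 f = log_form lam A i"
    by (rule closed_imp_log_form) blast
  have V: "V i = Phi lam A i" if "i < 3" for i
  proof -
    have "emb3 (V i) / emb3 f = emb3 (Phi lam A i) / emb3 f"
      by (simp only: eq[OF that] emb_Phi[OF that])
    then show ?thesis using nz(1) by simp
  qed
  from V[of 0] V[of 1] V[of 2] have GHK: "G = Phi lam A 0" "H = Phi lam A 1" "K = Phi lam A 2"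
    by (simp_all add: V_def)
  define mu where "mu = (\<Sum>j<r. lam j * of_nat (ds j))"
  have "S * (q * [:[:[:mu:]:]:] + (euler A - of_nat s * A)) = 0"
    using K unfolding GHK euler_Phi mu_def .
  then have z: "[:[:[:mu:]:]:] * q + (euler A - [:[:[:of_nat s:]:]:] * A) = 0"
    using nz unfolding const3_of_nat by (simp add: mult.commute)
  \<comment> \<open>The equation separates by degree: \<open>q\<close> has only degree s, while
    euler - s vanishes in degree s and is invertible in every other. So \<open>A\<close> has no part
    outside degree s, and then \<open>mu\<close> is 0.\<close>
  have m: "mu * mcoeff q i j k + (of_nat (i + j + k) - of_nat s) * mcoeff A i j k = 0" for i j k
    using arg_cong[OF z, of "\<lambda>p. mcoeff p i j k"]
    unfolding mcoeff_add mcoeff_diff mcoeff_const_mult mcoeff_euler mcoeff_0 by (simp only: algebra_simps)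
  have A: "homogeneous A s"
    unfolding homogeneous_def
  proof (intro allI impI, rule ccontr)
    fix i j k assume a: "mcoeff A i j k \<noteq> 0" "i + j + k \<noteq> s"
    have "homogeneous q s" using weight_q homogeneous_iff_weight by blast
    then have "mcoeff q i j k = 0" using a(2) unfolding homogeneous_def by blast
    then have "(of_nat (i + j + k) - of_nat s :: 'a) = 0" using m[of i j k] a(1) by simp
    then show False using a(2) by (simp only: right_minus_eq of_nat_eq_iff)
  qed
  then have "euler A = [:[:[:of_nat s:]:]:] * A" using homogeneous_iff_weight weight_def by blast
  then have "[:[:[:mu:]:]:] * q = 0" using z by simp
  then have "mu = 0" using nz by simp
  then show ?thesis using A GHK unfolding mu_def by blast
qed

end

section \<open>The dimension count\<close>

lemma vector_space_sc_pair: "vector_space (sc_pair :: 'a::field \<Rightarrow> 'a poly3 \<times> 'a poly3 \<Rightarrow> _)"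
proof -
  have "smult [:[:a + b:]:] p = smult [:[:a:]:] p + smult [:[:b:]:] p" for a b :: 'a and p
    by (simp flip: smult_add_left)
  then show ?thesis
    by unfold_locales (auto simp: sc_pair_def sc3_def prod_eq_iff smult_add_right mult.commute)
qed

text \<open>Reads the dimension off an indexed parametrization. Independence in the library sense
  concerns the set of vectors, so the family must first be shown injective.\<close>

lemma dimK_eq_card:
  fixes v :: "'i \<Rightarrow> 'a::field poly3 \<times> 'a poly3"
  assumes I: "finite I"
    and indep: "\<And>c. (\<Sum>x\<in>I. sc_pair (c x) (v x)) = 0 \<Longrightarrow> \<forall>x\<in>I. c x = 0"
    and W: "W = range (\<lambda>c. \<Sum>x\<in>I. sc_pair (c x) (v x))"
  shows "dimK W = card I"
proof -
  interpret V: vector_space "sc_pair :: 'a \<Rightarrow> 'a poly3 \<times> 'a poly3 \<Rightarrow> _"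
    by (rule vector_space_sc_pair)
  have inj: "inj_on v I"
  proof (rule inj_onI, rule ccontr)
    fix x y assume xy: "x \<in> I" "y \<in> I" "v x = v y" "x \<noteq> y"
    \<comment> \<open>A repeated vector would give the nontrivial relation
      \<open>v x - v y = 0\<close>.\<close>
    define c :: "'i \<Rightarrow> 'a" where "c z = (if z = x then 1 else if z = y then - 1 else 0)" for z
    have "(\<Sum>z\<in>I. sc_pair (c z) (v z)) = (\<Sum>z\<in>{x, y}. sc_pair (c z) (v z))"
      using xy I by (intro sum.mono_neutral_right) (auto simp: c_def)
    also have "\<dots> = 0" using xy by (simp add: c_def)
    finally have "\<forall>z\<in>I. c z = 0" by (rule indep)
    then show False using xy(1) by (auto simp: c_def)
  qed
  have reindex: "(\<Sum>w\<in>v ` I. sc_pair (u w) w) = (\<Sum>x\<in>I. sc_pair (u (v x)) (v x))" for u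
    by (simp add: sum.reindex[OF inj])
  have ind: "V.independent (v ` I)"
  proof
    assume "V.dependent (v ` I)"
    then obtain u where u: "\<exists>w\<in>v ` I. u w \<noteq> 0" "(\<Sum>w\<in>v ` I. sc_pair (u w) w) = 0"
      using V.dependent_finite[of "v ` I"] I by auto
    from indep[of "u \<circ> v"] u(2) have "\<forall>x\<in>I. u (v x) = 0" by (simp add: reindex)
    then show False using u(1) by auto
  qed
  have span: "W = V.span (v ` I)"
  proof -
    have "(\<Sum>x\<in>I. sc_pair (c x) (v x)) \<in> range (\<lambda>u. \<Sum>w\<in>v ` I. sc_pair (u w) w)" for c
    proof (rule range_eqI)
      show "(\<Sum>x\<in>I. sc_pair (c x) (v x)) = (\<Sum>w\<in>v ` I. sc_pair ((c \<circ> the_inv_into I v) w) w)"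
        unfolding reindex by (intro sum.cong) (auto simp: the_inv_into_f_f[OF inj])
    qed
    moreover have "(\<Sum>w\<in>v ` I. sc_pair (u w) w) \<in> W" for u
      unfolding W reindex by (rule range_eqI[of _ _ "u \<circ> v"]) simp
    ultimately show ?thesis
      unfolding V.span_finite[OF finite_imageI[OF I]] unfolding W by auto
  qed
  have "V.dim W = card (v ` I)"
    unfolding span by (rule V.dim_span_eq_card_independent[OF ind])
  then show ?thesis by (simp add: dimK_def card_image[OF inj])
qed

section \<open>Monomials of a fixed degree\<close>

definition exponents :: "nat \<Rightarrow> (nat \<times> nat \<times> nat) set" where
  "exponents n = {(i, j, k). i + j + k = n}"

lemma exponents_eq: "exponents n = (\<lambda>(i, j). (i, j, n - i - j)) ` (SIGMA i:{..n}. {..n - i})"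
  by (force simp: exponents_def)

lemma finite_exponents: "finite (exponents n)"
  by (simp add: exponents_eq)

lemma card_exponents: "card (exponents n) = (n + 2) choose 2"
proof -
  have "card (exponents n) = card (SIGMA i:{..n}. {..n - i})"
    unfolding exponents_eq by (rule card_image) (auto simp: inj_on_def)
  also have "\<dots> = (\<Sum>i\<le>n. Suc (n - i))" by simp
  also have "\<dots> = (\<Sum>i\<le>n. Suc i)" by (rule sum.nat_diff_reindex[of "\<lambda>i. Suc i" "Suc n", unfolded lessThan_Suc_atMost, simplified])
  also have "\<dots> = (n + 2) choose 2" by (induction n) (simp_all add: numeral_2_eq_2)
  finally show ?thesis .
qed

definition monomial :: "nat \<times> nat \<times> nat \<Rightarrow> 'a::comm_ring_1 poly3" where
  "monomial = (\<lambda>(i, j, k). monom (monom (monom 1 i) j) k)"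

definition mcf :: "'a::zero poly3 \<Rightarrow> nat \<times> nat \<times> nat \<Rightarrow> 'a" where
  "mcf p = (\<lambda>(i, j, k). mcoeff p i j k)"

lemma mcf_eqI: "(\<And>m. mcf p m = mcf q m) \<Longrightarrow> p = q"
  by (rule mcoeff_eqI) (simp add: mcf_def split_paired_all)

lemma mcf_monomial: "mcf (monomial m) m' = (if m = m' then 1 else 0)"
  by (auto simp: mcf_def monomial_def mcoeff_def split: prod.splits)

lemma mcf_sc3: "mcf (sc3 c p) m = c * mcf p m"
  by (auto simp: mcf_def mcoeff_sc3 split: prod.splits)

lemma mcf_diff: "mcf (p - q) m = mcf p m - mcf q m" for p q :: "'a::ab_group_add poly3"
  by (auto simp: mcf_def mcoeff_diff split: prod.splits)

lemma mcf_sum: "mcf (\<Sum>x\<in>X. g x) m = (\<Sum>x\<in>X. mcf (g x) m)"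
  for g :: "'b \<Rightarrow> 'a::ab_group_add poly3"
  by (induction X rule: infinite_finite_induct)
    (auto simp: mcf_def mcoeff_0 mcoeff_add split: prod.splits)

lemma homogeneous_iff_mcf: "homogeneous p n \<longleftrightarrow> (\<forall>m. m \<notin> exponents n \<longrightarrow> mcf p m = 0)"
  by (auto simp: homogeneous_def mcf_def exponents_def)

lemma mcf_monomial_sum:
  assumes "finite X"
  shows "mcf (\<Sum>m\<in>X. sc3 (c m) (monomial m)) m' = (if m' \<in> X then c m' else 0)"
  using assms by (simp add: mcf_sum mcf_sc3 mcf_monomial if_distrib cong: if_cong)

section \<open>A basis of the kernel\<close>

context homogeneous_factored
begin

definition Phi2 :: "(nat \<Rightarrow> 'a) \<Rightarrow> 'a poly3 \<Rightarrow> 'a poly3 \<times> 'a poly3" where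
  "Phi2 lam A = (Phi lam A 0, Phi lam A 1)"

lemma Phi_add: "Phi (\<lambda>j. l j + l' j) (A + A') i = Phi l A i + Phi l' A' i"
  unfolding Phi_def const3_simps derivation_add[OF derivation_partial] distrib_right sum.distrib distrib_left
  by simp

lemma Phi_scale: "Phi (\<lambda>j. c * l j) (sc3 c A) i = sc3 c (Phi l A i)"
proof -
  have p: "partial i (sc3 c A) = sc3 c (partial i A)"
    unfolding sc3_def derivation_mult[OF derivation_partial] partial_const by simp
  have l: "(\<Sum>j<r. [:[:[:c * l j:]:]:] * cof j * partial i (fs j))
      = [:[:[:c:]:]:] * (\<Sum>j<r. [:[:[:l j:]:]:] * cof j * partial i (fs j))"
    unfolding const3_simps(2) sum_distrib_left by (simp only: mult.assoc)
  show ?thesis unfolding Phi_def p l unfolding sc3_def by (simp only: algebra_simps)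
qed

lemma Phi_0: "Phi (\<lambda>_. 0) 0 i = 0"
  by (simp add: Phi_def derivation_0[OF derivation_partial])

lemma Phi_cong: "(\<And>j. j < r \<Longrightarrow> l j = l' j) \<Longrightarrow> Phi l A i = Phi l' A i"
  unfolding Phi_def by simp

lemma Phi2_sum:
  "(\<Sum>x\<in>I. sc_pair (c x) (Phi2 (L x) (B x)))
    = Phi2 (\<lambda>j. \<Sum>x\<in>I. c x * L x j) (\<Sum>x\<in>I. sc3 (c x) (B x))"
proof (induction I rule: infinite_finite_induct)
  case (insert x I)
  then show ?case
    by (simp add: Phi2_def sc_pair_def Phi_add Phi_scale[symmetric])
qed (simp_all add: Phi2_def Phi_0 zero_prod_def)

text \<open>The form in question is d(q/q) = 0; this is the direction in which \<open>A\<close> is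
  undetermined.\<close>

lemma Phi_q: "i < 3 \<Longrightarrow> Phi (\<lambda>_. 0) q i = 0"
  using emb_Phi[of i "\<lambda>_. 0" q] nz by (simp add: log_form_def derivation_1[OF T.der])

lemma Phi2_diff_q: "Phi2 l (A - sc3 c q) = Phi2 l A"
proof -
  have "Phi l A i = Phi l (A - sc3 c q) i" if "i < 3" for i
  proof -
    have "Phi l A i = Phi (\<lambda>j. l j + c * 0) ((A - sc3 c q) + sc3 c q) i" by simp
    also have "\<dots> = Phi l (A - sc3 c q) i + sc3 c (Phi (\<lambda>_. 0) q i)"
      unfolding Phi_add Phi_scale ..
    finally show ?thesis using Phi_q[OF that] by (simp add: sc3_def)
  qed
  then show ?thesis by (simp add: Phi2_def)
qed

text \<open>The pair determines the third component through the Euler relation, since Z can be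
  cancelled; so the whole form vanishes and \<open>log_form_eq_0\<close> applies.\<close>

lemma Phi2_eq_0:
  assumes A: "homogeneous A s" and lam: "(\<Sum>j<r. lam j * of_nat (ds j)) = 0" and z: "Phi2 lam A = 0"
  shows "\<forall>j<r. lam j = 0" and "\<exists>k. A = sc3 k q"
proof -
  have eu: "euler A = of_nat s * A"
    using A unfolding homogeneous_iff_weight weight_def const3_of_nat .
  have z01: "Phi lam A 0 = 0" "Phi lam A 1 = 0" using z by (simp_all add: Phi2_def zero_prod_def)
  have "varZ * Phi lam A 2 = 0"
    using euler_Phi[of lam A] unfolding lam eu z01 by simp
  then have "Phi lam A 2 = 0" by (simp add: varZ_nz)
  then have "Phi lam A i = 0" if "i < 3" for i
    using z01 that by (auto simp: numeral_3_eq_3 numeral_2_eq_2 less_Suc_eq)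
  then have lf: "log_form lam A i = 0" if "i < 3" for i
    using emb_Phi[OF that, of lam A] that by simp
  show "\<forall>j<r. lam j = 0" "\<exists>k. A = sc3 k q"
    unfolding sc3_def by (rule log_form_eq_0[OF lf], assumption)+
qed

text \<open>A form of degree 0 is a constant, hence not prime. This permits solving the relation
  between residues for the one at index 0.\<close>

lemma ds_nz: "i < r \<Longrightarrow> ds i \<noteq> 0"
proof
  assume i: "i < r" and "ds i = 0"
  then have hom: "homogeneous (fs i) 0" using hom_fs by metis
  have "mcoeff (fs i) a b c = mcoeff [:[:[:mcoeff (fs i) 0 0 0:]:]:] a b c" for a b c
    using hom unfolding homogeneous_def
    by (cases a; cases b; cases c) (auto simp: mcoeff_def[of "[:_:]"])
  then have "fs i = [:[:[:mcoeff (fs i) 0 0 0:]:]:]" by (rule mcoeff_eqI)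
  then have "fs i dvd 1" using poly3_const_unit fs_nz[OF i] by (metis pCons_0_0)
  then show False using prime_elem_not_unit[OF prime_fs[OF i]] by simp
qed

lemma r_pos: "r > 0"
proof (rule ccontr)
  assume "\<not> r > 0"
  then have "f = 1" unfolding f_def by simp
  then have "weight (of_nat d) (1 :: 'a poly3)" using weight_f by simp
  from weight_unique[OF this weight_1] d_pos show False by simp
qed

text \<open>Basis vectors, for j from 1 to r - 1, of the hyperplane of residues on which the sum of
  the \<open>lam i * ds i\<close> is 0; the entry at 0 compensates the entry at j.\<close>

definition basis_lam :: "nat \<Rightarrow> nat \<Rightarrow> 'a" where
  "basis_lam j i = (if i = j then 1 else if i = 0 then - of_nat (ds j) / of_nat (ds 0) else 0)"

lemma sum_basis_lam:
  "(\<Sum>j\<in>{1..<r}. c j * basis_lam j i) = (if i \<in> {1..<r} then c i else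
     if i = 0 then - (\<Sum>j\<in>{1..<r}. c j * of_nat (ds j)) / of_nat (ds 0) else 0)"
proof (cases "i = 0")
  case True
  then show ?thesis
    by (simp add: basis_lam_def sum_divide_distrib sum_negf[symmetric] cong: if_cong)
next
  case False
  then show ?thesis by (simp add: basis_lam_def if_distrib cong: if_cong)
qed

lemma sum_lessThan_split: "(\<Sum>j<r. g j) = g 0 + (\<Sum>j\<in>{1..<r}. g j)" for g :: "nat \<Rightarrow> 'a"
  using r_pos by (simp add: lessThan_atLeast0 sum.atLeast_Suc_lessThan)

lemma dimK_Rker: "int (dimK (Rker d f)) = int r - 2 + int ((2 + s) choose 2)"
proof -
  have d0: "(of_nat (ds 0) :: 'a) \<noteq> 0" using ds_nz[OF r_pos] by simp
  have qs: "homogeneous q s" using weight_q homogeneous_iff_weight by blast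
  have "\<exists>m. mcf q m \<noteq> 0" using mcf_eqI[of q 0] nz by (auto simp: mcf_def mcoeff_0)
  then obtain m0 where m0: "mcf q m0 \<noteq> 0" ..
  then have m0s: "m0 \<in> exponents s" using qs unfolding homogeneous_iff_mcf by blast
  \<comment> \<open>Omitting one monomial \<open>m0\<close> that occurs in \<open>q\<close> leaves
    monomials spanning a complement of the line through \<open>q\<close> in degree s.\<close>
  define M where "M = exponents s - {m0}"
  have finM: "finite M" by (simp add: M_def finite_exponents)
  define I where "I = Inl ` {1..<r} \<union> Inr ` M"
  define L where "L x = (case x of Inl j \<Rightarrow> basis_lam j | Inr m \<Rightarrow> (\<lambda>_. 0))" for x :: "nat + nat \<times> nat \<times> nat"
  define B :: "nat + nat \<times> nat \<times> nat \<Rightarrow> 'a poly3" where "B x = (case x of Inl j \<Rightarrow> 0 | Inr m \<Rightarrow> monomial m)" for x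
  have finI: "finite I" using finM by (simp add: I_def)
  have split: "(\<Sum>x\<in>I. g x) = (\<Sum>j\<in>{1..<r}. g (Inl j)) + (\<Sum>m\<in>M. g (Inr m))"
    for g :: "_ \<Rightarrow> 'b::comm_monoid_add"
    unfolding I_def using finM by (subst sum.union_disjoint) (auto simp: sum.reindex)
  define lam where "lam c j = (\<Sum>x\<in>I. c x * L x j)" for c j
  define A where "A c = (\<Sum>x\<in>I. sc3 (c x) (B x))" for c
  have lam: "lam c i = (if i \<in> {1..<r} then c (Inl i) else
     if i = 0 then - (\<Sum>j\<in>{1..<r}. c (Inl j) * of_nat (ds j)) / of_nat (ds 0) else 0)" for c i
    unfolding lam_def split by (simp add: L_def sum_basis_lam del: One_nat_def)
  have A: "A c = (\<Sum>m\<in>M. sc3 (c (Inr m)) (monomial m))" for c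
    unfolding A_def split by (simp add: B_def sc3_def)
  have mcfA: "mcf (A c) m = (if m \<in> M then c (Inr m) else 0)" for c m
    unfolding A by (rule mcf_monomial_sum[OF finM])
  have comb: "(\<Sum>x\<in>I. sc_pair (c x) (Phi2 (L x) (B x))) = Phi2 (lam c) (A c)" for c
    unfolding Phi2_sum lam_def A_def ..
  have homA: "homogeneous (A c) s" for c
    unfolding homogeneous_iff_mcf mcfA by (simp add: M_def)
  have lam0: "(\<Sum>j<r. lam c j * of_nat (ds j)) = 0" for c
    unfolding sum_lessThan_split using d0 by (simp add: lam)
  have "dimK (Rker d f) = card I"
  proof (rule dimK_eq_card[OF finI])
    fix c assume "(\<Sum>x\<in>I. sc_pair (c x) (Phi2 (L x) (B x))) = 0"
    then have z: "Phi2 (lam c) (A c) = 0" unfolding comb .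
    note l0 = Phi2_eq_0(1)[OF homA lam0 z]
    obtain k where k: "A c = sc3 k q" using Phi2_eq_0(2)[OF homA lam0 z] ..
    \<comment> \<open>A combination of the monomials in \<open>M\<close> has no coefficient at
      \<open>m0\<close>, whereas a nonzero multiple of \<open>q\<close> has one.\<close>
    have "mcf (A c) m0 = 0" by (simp add: mcfA M_def)
    then have "k = 0" using m0 by (simp add: k mcf_sc3)
    then have "A c = 0" by (simp add: k sc3_def)
    then have "c (Inr m) = 0" if "m \<in> M" for m
      using mcfA[of c m] that by (simp add: mcf_def mcoeff_0 split: prod.splits)
    moreover have "c (Inl j) = 0" if "j \<in> {1..<r}" for j
      using l0 lam[of c j] that by simp
    ultimately show "\<forall>x\<in>I. c x = 0" by (auto simp: I_def)
  next
    show "Rker d f = range (\<lambda>c. \<Sum>x\<in>I. sc_pair (c x) (Phi2 (L x) (B x)))"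
    proof (intro subset_antisym subsetI)
      fix v assume "v \<in> range (\<lambda>c. \<Sum>x\<in>I. sc_pair (c x) (Phi2 (L x) (B x)))"
      then obtain c where "v = Phi2 (lam c) (A c)" by (auto simp: comb)
      then show "v \<in> Rker d f" unfolding Phi2_def using Rker_Phi[OF homA lam0] by simp
    next
      fix v assume v: "v \<in> Rker d f"
      obtain G H where GH: "v = (G, H)" by (cases v)
      from Rker_imp_Phi[OF v[unfolded GH]] obtain l A' where
        A': "homogeneous A' s" and l: "(\<Sum>j<r. l j * of_nat (ds j)) = 0" and vl: "v = Phi2 l A'"
        by (auto simp: Phi2_def GH)
      \<comment> \<open>Subtracting this multiple of \<open>q\<close> removes the coefficient at
        \<open>m0\<close> and leaves the form unchanged by \<open>Phi2_diff_q\<close>.\<close>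
      define A'' where "A'' = A' - sc3 (mcf A' m0 / mcf q m0) q"
      define c where "c x = (case x of Inl j \<Rightarrow> l j | Inr m \<Rightarrow> mcf A'' m)" for x
      have "A'' = A c"
      proof (rule mcf_eqI)
        fix m
        show "mcf A'' m = mcf (A c) m"
        proof (cases "m \<in> M")
          case False
          then consider "m = m0" | "m \<notin> exponents s" by (auto simp: M_def)
          then have "mcf A'' m = 0"
            using A' qs m0 unfolding homogeneous_iff_mcf
            by cases (simp_all add: A''_def mcf_diff mcf_sc3 del: split_paired_All)
          then show ?thesis using False by (simp add: mcfA)
        qed (simp add: mcfA c_def)
      qed
      moreover have "Phi l A'' i = Phi (lam c) A'' i" for i
      proof (rule Phi_cong)
        fix j assume j: "j < r"
        \<comment> \<open>The residues at indices from 1 on are the chosen coefficients; the one at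
          0 is forced by the relation.\<close>
        have "l 0 * of_nat (ds 0) = - (\<Sum>j\<in>{1..<r}. l j * of_nat (ds j))"
          using l unfolding sum_lessThan_split by (simp only: add_eq_0_iff2)
        then show "l j = lam c j"
          using j d0 by (cases "j = 0") (simp_all add: lam c_def field_simps)
      qed
      ultimately have "v = Phi2 (lam c) (A c)"
        unfolding vl Phi2_diff_q[of l A' "mcf A' m0 / mcf q m0", symmetric] A''_def[symmetric]
        by (simp add: Phi2_def)
      then show "v \<in> range (\<lambda>c. \<Sum>x\<in>I. sc_pair (c x) (Phi2 (L x) (B x)))"
        unfolding comb by (intro image_eqI[where x = c]) simp_all
    qed
  qed
  also have "card I = (r - 1) + (card (exponents s) - 1)"
    unfolding I_def using finM m0s
    by (subst card_Un_disjoint) (auto simp: card_image M_def)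
  finally have "dimK (Rker d f) = (r - 1) + (((s + 2) choose 2) - 1)"
    unfolding card_exponents .
  \<comment> \<open>With \<open>r_pos\<close> this ensures that neither natural subtraction
    truncates.\<close>
  moreover have "(s + 2) choose 2 > 0" by (rule zero_less_binomial) simp
  ultimately show ?thesis using r_pos unfolding add.commute[of 2 s] by linarith
qed

text \<open>The expression is r - 1 plus a binomial coefficient minus 1, both non-negative. It
  vanishes iff r = 1 and s = 0, and then \<open>es 0 = 1\<close> because \<open>ds 0\<close> is
  positive. Conversely, the cofactor of \<open>fs 0\<close> in an irreducible f is a unit, leaving
  no room for further factors.\<close>

lemma irreducible_iff_dim: "irreducible f \<longleftrightarrow> int r - 2 + int ((2 + s) choose 2) = 0"
proof
  assume irr: "irreducible f"
  have not_unit: "\<not> fs i dvd 1" if "i < r" for i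
    using prime_elem_not_unit[OF prime_fs[OF that]] .
  have "f = fs 0 ^ es 0 * (\<Prod>i\<in>{..<r} - {0}. fs i ^ es i)"
    unfolding f_def using r_pos by (simp add: prod.remove)
  also have "fs 0 ^ es 0 = fs 0 * fs 0 ^ (es 0 - 1)"
    using es_pos[OF r_pos] by (cases "es 0") auto
  finally have "f = fs 0 * (fs 0 ^ (es 0 - 1) * (\<Prod>i\<in>{..<r} - {0}. fs i ^ es i))"
    by (simp only: mult.assoc)
  from irreducibleD[OF irr this] not_unit[OF r_pos]
  have u: "fs 0 ^ (es 0 - 1) dvd 1" "(\<Prod>i\<in>{..<r} - {0}. fs i ^ es i) dvd 1"
    by (auto simp: is_unit_mult_iff)
  have es0: "es 0 = 1"
  proof (rule ccontr)
    assume "es 0 \<noteq> 1"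
    then have "fs 0 dvd fs 0 ^ (es 0 - 1)" using es_pos[OF r_pos] by (intro dvd_power) auto
    then show False using u(1) not_unit[OF r_pos] dvd_trans by blast
  qed
  have r1: "r = 1"
  proof (rule ccontr)
    assume "r \<noteq> 1"
    then have r: "1 < r" using r_pos by simp
    have "fs 1 dvd fs 1 ^ es 1" using es_pos[OF r] by (intro dvd_power) auto
    also have "\<dots> dvd (\<Prod>i\<in>{..<r} - {0}. fs i ^ es i)" using r by (intro dvd_prodI) auto
    finally show False using u(2) not_unit[OF r] dvd_trans by blast
  qed
  show "int r - 2 + int ((2 + s) choose 2) = 0"
  proof -
    have "s = 0" unfolding s_def using r1 es0 by simp
    then show ?thesis unfolding \<open>s = 0\<close> using r1 by simp
  qed
next
  assume "int r - 2 + int ((2 + s) choose 2) = 0"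
  moreover have "s = 0" if "(2 + s) choose 2 \<le> 1"
  proof (rule ccontr)
    assume "s \<noteq> 0"
    then have "3 choose 2 \<le> (2 + s) choose 2" by (intro binomial_right_mono) auto
    then show False using that by (simp add: numeral_3_eq_3 numeral_2_eq_2)
  qed
  moreover have "(2 + s) choose 2 > 0" by (rule zero_less_binomial) simp
  ultimately have r1: "r = 1" and "s = 0" using r_pos by linarith+
  then have "ds 0 * (es 0 - 1) = 0" unfolding s_def by simp
  then have "es 0 = 1" using ds_nz[OF r_pos] es_pos[OF r_pos] by simp
  then have "f = fs 0" unfolding f_def using r1 by simp
  then show "irreducible f" using prime_fs[OF r_pos] by simp
qed

end

theorem theorem1p8:
  fixes f :: "'a::{alg_closed_field, field_char_0} poly3"
    and d r :: nat
    and fs :: "nat \<Rightarrow> 'a poly3"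
    and es ds :: "nat \<Rightarrow> nat"
  assumes "d \<ge> 1"
    and "homogeneous f d"
    and "f = (\<Prod>i<r. fs i ^ es i)"
    and "\<forall>i<r. irreducible (fs i) \<and> homogeneous (fs i) (ds i) \<and> es i \<ge> 1"
    and "\<forall>i<r. \<forall>j<r. i \<noteq> j \<longrightarrow> \<not> (\<exists>c. fs i = sc3 c (fs j))"
  shows "int (dimK (Rker d f)) =
           int r - 2 + int ((2 + (\<Sum>i<r. ds i * (es i - 1))) choose 2)
         \<and> (irreducible f \<longleftrightarrow> dimK (Rker d f) = 0)"
proof -
  \<comment> \<open>Dividing irreducibles differ by a unit, and the units of K[X,Y,Z] are the
    nonzero constants, so non-proportional factors are non-associated.\<close>
  have nonassoc: "\<not> fs i dvd fs j" if ij: "i < r" "j < r" "i \<noteq> j" for i j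
  proof
    assume dvd: "fs i dvd fs j"
    have "prime_elem (fs i)" "prime_elem (fs j)" using assms(4) ij by auto
    from prime_elem_dvd_sym[OF this dvd] have "fs j dvd fs i" .
    then obtain w where w: "fs i = fs j * w" by (elim dvdE)
    have irr: "irreducible (fs i)" "irreducible (fs j)" using assms(4) ij by auto
    then have "w dvd 1" using irreducibleD[OF irr(1) w] irreducible_not_unit[OF irr(2)] by blast
    then obtain k where "w = [:[:[:k:]:]:]" by (rule poly3_unitE)
    then have "fs i = sc3 k (fs j)" using w by (simp add: sc3_def mult.commute)
    then show False using assms(5) ij by blast
  qed
  interpret F: factored r fs es
    using assms(4) nonassoc by unfold_locales auto
  have f: "F.f = f" by (simp add: F.f_def assms(3))
  interpret H: homogeneous_factored r fs es ds d
    using assms(1,2,4) by unfold_locales (auto simp: f)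
  have "int (dimK (Rker d f)) = int r - 2 + int ((2 + H.s) choose 2)"
    using H.dimK_Rker unfolding f .
  moreover from this have "irreducible f \<longleftrightarrow> dimK (Rker d f) = 0"
    using H.irreducible_iff_dim unfolding f by linarith
  ultimately show ?thesis unfolding H.s_def by (rule conjI)
qed

end
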